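(* Let $\mathcal{C}$ be an arbitrary set of corner minors of $M$. Then $$I(\mathcal{C})=\bigcap_{W\in\mathcal{W}}P_W(\mathcal{C})\ \cap\bigcap_{W\in\mathcal{W}\setminus\{\emptyset\}}\bigl(I(\mathcal{C})+(P_W(\mathcal{C}))^2\bigr).$$
   Context: Let $K$ be a field and $M=(x_{ij})$ an $m\times n$ matrix of indeterminates. A 2-minor is $\delta=[a_1,a_2|b_1,b_2]$ with $a_1<a_2$, $b_1<b_2$; $f_\delta=x_{a_1b_1}x_{a_2b_2}-x_{a_1b_2}x_{a_2b_1}$. Its vertex set is $V(\delta)=\{x_{a_1b_1},x_{a_1b_2},x_{a_2b_1},x_{a_2b_2}\}$; its edges are the horizontal edges $\{x_{a_1b_1},x_{a_1b_2}\}$, $\{x_{a_2b_1},x_{a_2b_2}\}$ and the vertical edges $\{x_{a_1b_1},x_{a_2b_1}\}$, $\{x_{a_1b_2},x_{a_2b_2}\}$. It is a corner minor if $a_1=1$ and $b_1=1$. For a set $\mathcal{C}$ of 2-minors, $V(\mathcal{C})$ and $E(\mathcal{C})$ are the unions of the vertex sets and edge sets of its members, $S=K[x_{ij}\mid x_{ij}\in V(\mathcal{C})]$, and $I(\mathcal{C})=(f_\delta\mid\delta\in\mathcal{C})\subset S$. A vertical interval of $\mathcal{C}$ is a set of vertices of $V(\mathcal{C})$ lying in one column of $M$ such that any two of them are joined by a path of vertical edges of $\mathcal{C}$; it is maximal if it is not strictly contained in another vertical interval. (Maximal) horizontal intervals are defined analogously with rows and horizontal edges. Let $V_1,\dots,V_p$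 and $H_1,\dots,H_q$ be the maximal vertical and maximal horizontal intervals of $\mathcal{C}$. $G(\mathcal{C})$ is the bipartite graph with vertices $v_1,\dots,v_p,h_1,\dots,h_q$ and edges $\{h_i,v_j\}$ for $H_i\cap V_j\ne\emptyset$; in that case $H_i\cap V_j$ is a single vertex, denoted $x_{a_i b_j}$. For a cycle $\sigma:h_{i_1},v_{j_1},\dots,h_{i_r},v_{j_r}$ ($r\ge2$) in $G(\mathcal{C})$ put $f_\sigma=\prod_{k=1}^r x_{a_{i_k},b_{j_k}}-\prod_{k=1}^r x_{a_{i_{k+1}},b_{j_k}}$ with $i_{r+1}=i_1$. $J_{\mathcal{C}}$ is the ideal generated by all $f_\sigma$, $\sigma$ a cycle in $G(\mathcal{C})$. For $\mathcal{D}\subset\mathcal{C}$, $J_{\mathcal{D}}$ is formed from the intervals of $\mathcal{D}$ and regarded as an ideal of $S$ by extension (zero if $\mathcal{D}=\emptyset$). A subset $W\subset V(\mathcal{C})$ is admissible if for each $\delta\in\mathcal{C}$ either $W\cap V(\delta)=\emptyset$ or $W\cap V(\delta)$ contains an edge of $\delta$. For admissible $W$, $P_W(\mathcal{C})=(x_{ij}\mid x_{ij}\in W)+J_{\mathcal{C}'}\subset S$ with $\mathcal{C}'=\{\delta\in\mathcal{C}\mid V(\delta)\cap W=\emptyset\}$. $\mathcal{W}$ denotes the set of all admissible $W\subset V(\mathcal{C})$ such that $P_W(\mathcal{C})$ is a minimal prime of $I(\mathcal{C})$. An intersection over an empty index set is $S$. *)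

theory Defs
  imports
    "HOL-Library.Poly_Mapping"
    "HOL-Algebra.Ideal_Product"
begin

section \<open>Polynomial rings\<close>

text \<open>A vertex \<open>(i, j)\<close> stands for the matrix entry \<open>x\<^sub>i\<^sub>j\<close>. Monomials are finitely supported
  exponent functions on vertices; polynomials over the field \<open>'k\<close> are finitely supported
  coefficient functions on monomials.\<close>

type_synonym vertex = "nat \<times> nat"
type_synonym 'k mpoly = "(vertex \<Rightarrow>\<^sub>0 nat) \<Rightarrow>\<^sub>0 'k"

definition indet :: "vertex \<Rightarrow> 'k::field mpoly" where
  "indet v = Poly_Mapping.single (Poly_Mapping.single v 1) 1"

definition poly_vars :: "'k::field mpoly \<Rightarrow> vertex set" where
  "poly_vars p = (\<Union>t\<in>Poly_Mapping.keys p. Poly_Mapping.keys t)"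

text \<open>The polynomial ring \<open>K[x\<^sub>v | v \<in> V]\<close>.\<close>

definition polyring :: "vertex set \<Rightarrow> 'k::field mpoly ring" where
  "polyring V = \<lparr>carrier = {p. poly_vars p \<subseteq> V}, monoid.mult = (*), one = 1, zero = 0, add = (+)\<rparr>"

lemma polyring_simps [simp]:
  "carrier (polyring V) = {p. poly_vars p \<subseteq> V}"
  "monoid.mult (polyring V) = (*)" "one (polyring V) = 1"
  "zero (polyring V) = 0" "add (polyring V) = (+)"
  by (simp_all add: polyring_def)

lemma poly_vars_add: "poly_vars (p + q) \<subseteq> poly_vars p \<union> poly_vars q"
  using Poly_Mapping.keys_add[of p q] unfolding poly_vars_def by blast

lemma poly_vars_mult: "poly_vars (p * q) \<subseteq> poly_vars p \<union> poly_vars q"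
proof
  fix v assume "v \<in> poly_vars (p * q)"
  then obtain t where t: "t \<in> Poly_Mapping.keys (p * q)" "v \<in> Poly_Mapping.keys t"
    unfolding poly_vars_def by blast
  then obtain a b where ab: "t = a + b" "a \<in> Poly_Mapping.keys p" "b \<in> Poly_Mapping.keys q"
    using Poly_Mapping.keys_mult[of p q] by blast
  then have "v \<in> Poly_Mapping.keys a \<union> Poly_Mapping.keys b"
    using t(2) Poly_Mapping.keys_add[of a b] by blast
  then show "v \<in> poly_vars p \<union> poly_vars q"
    using ab unfolding poly_vars_def by blast
qed

lemma poly_vars_zero [simp]: "poly_vars 0 = {}"
  by (simp add: poly_vars_def)

lemma poly_vars_one [simp]: "poly_vars 1 = {}"
  by (simp add: poly_vars_def)

lemma poly_vars_uminus [simp]: "poly_vars (- p) = poly_vars p"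
  by (simp add: poly_vars_def)

lemma poly_vars_diff: "poly_vars (p - q) \<subseteq> poly_vars p \<union> poly_vars q"
  using poly_vars_add[of p "- q"] by simp

lemma poly_vars_indet [simp]: "poly_vars (indet v) = {v}"
  by (simp add: poly_vars_def indet_def)

lemma poly_vars_prod: "poly_vars (prod f A) \<subseteq> (\<Union>a\<in>A. poly_vars (f a))"
proof (induction A rule: infinite_finite_induct)
  case (insert a A)
  then show ?case using poly_vars_mult[of "f a" "prod f A"] by auto
qed auto

lemma cring_polyring: "cring (polyring V :: 'k::field mpoly ring)"
proof (rule cringI)
  show "abelian_group (polyring V :: 'k mpoly ring)"
  proof (rule abelian_groupI)
    fix x :: "'k mpoly" assume "x \<in> carrier (polyring V)"
    then show "\<exists>y\<in>carrier (polyring V). y \<oplus>\<^bsub>polyring V\<^esub> x = \<zero>\<^bsub>polyring V\<^esub>"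
      by (intro bexI[of _ "- x"]) auto
  qed (use poly_vars_add in \<open>fastforce simp: algebra_simps\<close>)+
  show "comm_monoid (polyring V :: 'k mpoly ring)"
    by (rule comm_monoidI) (use poly_vars_mult in \<open>fastforce simp: algebra_simps\<close>)+
qed (auto simp: algebra_simps)

section \<open>Sets of 2-minors\<close>

text \<open>The 2-minor \<open>[a\<^sub>1, a\<^sub>2 | b\<^sub>1, b\<^sub>2]\<close> is encoded as \<open>(a\<^sub>1, a\<^sub>2, b\<^sub>1, b\<^sub>2)\<close>; rows are numbered
  from \<open>1\<close> to \<open>m\<close> and columns from \<open>1\<close> to \<open>n\<close>.\<close>

type_synonym minor = "nat \<times> nat \<times> nat \<times> nat"

fun is_minor :: "nat \<Rightarrow> nat \<Rightarrow> minor \<Rightarrow> bool" where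
  "is_minor m n (a1, a2, b1, b2) \<longleftrightarrow>
     1 \<le> a1 \<and> a1 < a2 \<and> a2 \<le> m \<and> 1 \<le> b1 \<and> b1 < b2 \<and> b2 \<le> n"

fun is_corner_minor :: "nat \<Rightarrow> nat \<Rightarrow> minor \<Rightarrow> bool" where
  "is_corner_minor m n (a1, a2, b1, b2) \<longleftrightarrow> is_minor m n (a1, a2, b1, b2) \<and> a1 = 1 \<and> b1 = 1"

fun minor_poly :: "minor \<Rightarrow> 'k::field mpoly" where
  "minor_poly (a1, a2, b1, b2) =
     indet (a1, b1) * indet (a2, b2) - indet (a1, b2) * indet (a2, b1)"

fun minor_vertices :: "minor \<Rightarrow> vertex set" where
  "minor_vertices (a1, a2, b1, b2) = {(a1, b1), (a1, b2), (a2, b1), (a2, b2)}"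

fun minor_hedges :: "minor \<Rightarrow> vertex set set" where
  "minor_hedges (a1, a2, b1, b2) = {{(a1, b1), (a1, b2)}, {(a2, b1), (a2, b2)}}"

fun minor_vedges :: "minor \<Rightarrow> vertex set set" where
  "minor_vedges (a1, a2, b1, b2) = {{(a1, b1), (a2, b1)}, {(a1, b2), (a2, b2)}}"

definition minor_edges :: "minor \<Rightarrow> vertex set set" where
  "minor_edges d = minor_hedges d \<union> minor_vedges d"

definition vertices :: "minor set \<Rightarrow> vertex set" where
  "vertices C = (\<Union>d\<in>C. minor_vertices d)"

definition hedges :: "minor set \<Rightarrow> vertex set set" where
  "hedges C = (\<Union>d\<in>C. minor_hedges d)"

definition vedges :: "minor set \<Rightarrow> vertex set set" where
  "vedges C = (\<Union>d\<in>C. minor_vedges d)"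

definition coord_ring :: "minor set \<Rightarrow> 'k::field mpoly ring" where
  "coord_ring C = polyring (vertices C)"

definition minor_ideal :: "minor set \<Rightarrow> 'k::field mpoly set" where
  "minor_ideal C = Idl\<^bsub>coord_ring C\<^esub> (minor_poly ` C)"

section \<open>Intervals and the associated bipartite graph\<close>

definition joined_by_path :: "vertex set set \<Rightarrow> vertex \<Rightarrow> vertex \<Rightarrow> bool" where
  "joined_by_path E x y \<longleftrightarrow> (x, y) \<in> {(u, v). {u, v} \<in> E}\<^sup>*"

definition vertical_interval :: "minor set \<Rightarrow> vertex set \<Rightarrow> bool" where
  "vertical_interval C A \<longleftrightarrow> A \<noteq> {} \<and> A \<subseteq> vertices C \<and> (\<exists>j. \<forall>x\<in>A. snd x = j) \<and>
     (\<forall>x\<in>A. \<forall>y\<in>A. joined_by_path (vedges C) x y)"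

definition horizontal_interval :: "minor set \<Rightarrow> vertex set \<Rightarrow> bool" where
  "horizontal_interval C A \<longleftrightarrow> A \<noteq> {} \<and> A \<subseteq> vertices C \<and> (\<exists>i. \<forall>x\<in>A. fst x = i) \<and>
     (\<forall>x\<in>A. \<forall>y\<in>A. joined_by_path (hedges C) x y)"

definition max_vertical_intervals :: "minor set \<Rightarrow> vertex set set" where
  "max_vertical_intervals C =
     {A. vertical_interval C A \<and> \<not> (\<exists>B. vertical_interval C B \<and> A \<subset> B)}"

definition max_horizontal_intervals :: "minor set \<Rightarrow> vertex set set" where
  "max_horizontal_intervals C =
     {A. horizontal_interval C A \<and> \<not> (\<exists>B. horizontal_interval C B \<and> A \<subset> B)}"

text \<open>The graph \<open>G(C)\<close>: the vertex \<open>h\<^sub>i\<close> is \<open>Inl H\<^sub>i\<close> and the vertex \<open>v\<^sub>j\<close> is \<open>Inr V\<^sub>j\<close>.\<close>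

definition interval_graph_verts :: "minor set \<Rightarrow> (vertex set + vertex set) set" where
  "interval_graph_verts C = max_horizontal_intervals C <+> max_vertical_intervals C"

definition interval_graph_edges :: "minor set \<Rightarrow> (vertex set + vertex set) set set" where
  "interval_graph_edges C = {{Inl H, Inr V} | H V. Inl H \<in> interval_graph_verts C \<and>
     Inr V \<in> interval_graph_verts C \<and> H \<inter> V \<noteq> {}}"

text \<open>The lists \<open>hs\<close> and \<open>vs\<close> represent the closed walk
  \<open>hs ! 0, vs ! 0, hs ! 1, vs ! 1, \<dots>, hs ! (r - 1), vs ! (r - 1), hs ! 0\<close> with \<open>r = length hs\<close>.\<close>

definition interval_cycle :: "minor set \<Rightarrow> vertex set list \<Rightarrow> vertex set list \<Rightarrow> bool" where
  "interval_cycle C hs vs \<longleftrightarrow>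
     2 \<le> length hs \<and> length vs = length hs \<and> distinct hs \<and> distinct vs \<and>
     (\<forall>k<length hs. {Inl (hs ! k), Inr (vs ! k)} \<in> interval_graph_edges C \<and>
        {Inl (hs ! (Suc k mod length hs)), Inr (vs ! k)} \<in> interval_graph_edges C)"

text \<open>For a horizontal interval \<open>H\<close> in row \<open>a\<close> and a vertical interval \<open>V\<close> in column \<open>b\<close> that meet,
  \<open>the_elem (H \<inter> V)\<close> is \<open>(a, b)\<close>.\<close>

definition cycle_poly :: "vertex set list \<Rightarrow> vertex set list \<Rightarrow> 'k::field mpoly" where
  "cycle_poly hs vs =
     (\<Prod>k<length hs. indet (the_elem (hs ! k \<inter> vs ! k))) -
     (\<Prod>k<length hs. indet (the_elem (hs ! (Suc k mod length hs) \<inter> vs ! k)))"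

text \<open>For \<open>D \<subseteq> C\<close>, the extension of \<open>J\<^sub>D\<close> to the ring \<open>S\<close> of \<open>C\<close>, i.e. the ideal of \<open>S\<close>
  generated by the cycle binomials of \<open>D\<close>.\<close>

definition cycle_ideal :: "minor set \<Rightarrow> minor set \<Rightarrow> 'k::field mpoly set" where
  "cycle_ideal C D =
     Idl\<^bsub>coord_ring C\<^esub> {cycle_poly hs vs | hs vs. interval_cycle D hs vs}"

lemma interval_graph_edge_meet:
  assumes "{Inl H, Inr V} \<in> interval_graph_edges D"
  shows "\<exists>x\<in>vertices D. H \<inter> V = {x}"
proof -
  have "H \<inter> V \<noteq> {}" "horizontal_interval D H" "vertical_interval D V"
    using assms unfolding interval_graph_edges_def interval_graph_verts_def
      max_horizontal_intervals_def max_vertical_intervals_def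
    by (auto simp: doubleton_eq_iff)
  then obtain x i j where x: "x \<in> H \<inter> V" "\<forall>y\<in>H. fst y = i" "\<forall>y\<in>V. snd y = j" "H \<subseteq> vertices D"
    unfolding horizontal_interval_def vertical_interval_def by blast
  then have "y = x" if "y \<in> H \<inter> V" for y using that by (metis IntE prod_eqI)
  then have "H \<inter> V = {x}" using x(1) by blast
  with x show ?thesis by blast
qed

lemma cycle_poly_in_carrier:
  assumes "D \<subseteq> C" and "interval_cycle D hs vs"
  shows "(cycle_poly hs vs :: 'k::field mpoly) \<in> carrier (coord_ring C)"
proof -
  have "vertices D \<subseteq> vertices C" using assms(1) unfolding vertices_def by blast
  moreover have "the_elem (hs ! k \<inter> vs ! k) \<in> vertices D"
      "the_elem (hs ! (Suc k mod length hs) \<inter> vs ! k) \<in> vertices D" if "k < length hs" for k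
    using assms(2) that interval_graph_edge_meet[of "hs ! k" "vs ! k" D]
      interval_graph_edge_meet[of "hs ! (Suc k mod length hs)" "vs ! k" D]
    unfolding interval_cycle_def by auto
  moreover have "poly_vars (cycle_poly hs vs :: 'k mpoly) \<subseteq>
      (\<Union>k<length hs. {the_elem (hs ! k \<inter> vs ! k)}) \<union>
      (\<Union>k<length hs. {the_elem (hs ! (Suc k mod length hs) \<inter> vs ! k)})"
    unfolding cycle_poly_def
    by (rule order_trans[OF poly_vars_diff])
      (intro Un_mono order_trans[OF poly_vars_prod]; simp)
  ultimately have "poly_vars (cycle_poly hs vs :: 'k mpoly) \<subseteq> vertices C" by blast
  then show ?thesis by (simp add: coord_ring_def)
qed

lemma minor_poly_in_carrier:
  assumes "d \<in> C"
  shows "(minor_poly d :: 'k::field mpoly) \<in> carrier (coord_ring C)"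
proof -
  obtain a1 a2 b1 b2 where d: "d = (a1, a2, b1, b2)" by (metis prod_cases4)
  have "poly_vars (minor_poly d :: 'k mpoly) \<subseteq> minor_vertices d"
    using poly_vars_diff[of "indet (a1, b1) * indet (a2, b2) :: 'k mpoly"
        "indet (a1, b2) * indet (a2, b1)"]
      poly_vars_mult[of "indet (a1, b1) :: 'k mpoly" "indet (a2, b2)"]
      poly_vars_mult[of "indet (a1, b2) :: 'k mpoly" "indet (a2, b1)"]
    unfolding d minor_poly.simps minor_vertices.simps poly_vars_indet by blast
  then show ?thesis using assms unfolding coord_ring_def vertices_def by auto
qed

section \<open>Admissible sets and minimal primes\<close>

definition admissible :: "minor set \<Rightarrow> vertex set \<Rightarrow> bool" where
  "admissible C W \<longleftrightarrow> W \<subseteq> vertices C \<and>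
     (\<forall>d\<in>C. W \<inter> minor_vertices d = {} \<or> (\<exists>e\<in>minor_edges d. e \<subseteq> W \<inter> minor_vertices d))"

definition admissible_ideal :: "minor set \<Rightarrow> vertex set \<Rightarrow> 'k::field mpoly set" where
  "admissible_ideal C W =
     Idl\<^bsub>coord_ring C\<^esub> (indet ` W) <+>\<^bsub>coord_ring C\<^esub>
     cycle_ideal C {d \<in> C. minor_vertices d \<inter> W = {}}"

definition minimal_prime :: "('a, 'b) ring_scheme \<Rightarrow> 'a set \<Rightarrow> 'a set \<Rightarrow> bool" where
  "minimal_prime R I P \<longleftrightarrow> primeideal P R \<and> I \<subseteq> P \<and>
     (\<forall>Q. primeideal Q R \<and> I \<subseteq> Q \<and> Q \<subseteq> P \<longrightarrow> Q = P)"

text \<open>The set of admissible \<open>W\<close> whose ideal is a minimal prime of \<open>I(C)\<close>; the first argument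
  \<open>TYPE('k)\<close> selects the coefficient field.\<close>

definition minimal_admissible_sets :: "'k::field itself \<Rightarrow> minor set \<Rightarrow> vertex set set" where
  "minimal_admissible_sets _ C =
     {W. admissible C W \<and>
         minimal_prime (coord_ring C) (minor_ideal C) (admissible_ideal C W :: 'k mpoly set)}"

text \<open>Intersection of a family of ideals of \<open>R\<close>; the empty intersection is \<open>R\<close> itself.\<close>

definition ideal_Inter :: "('a, 'c) ring_scheme \<Rightarrow> 'b set \<Rightarrow> ('b \<Rightarrow> 'a set) \<Rightarrow> 'a set" where
  "ideal_Inter R A F = carrier R \<inter> (\<Inter>i\<in>A. F i)"

end

theory Submission
  imports Defs "HOL-Library.Product_Lexorder"
begin

text \<open>Write \<open>z = x\<^sub>1\<^sub>1\<close> and \<open>E\<close> for the set of all \<open>(a, b)\<close> with \<open>[1, a | 1, b] \<in> C\<close>, so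
  that \<open>I(C)\<close> is generated by \<open>z x\<^sub>a\<^sub>b - x\<^sub>1\<^sub>b x\<^sub>a\<^sub>1\<close> for \<open>(a, b) \<in> E\<close>. The ideal \<open>J\<^sub>C\<close> is the kernel
  of the Segre map, hence prime, and \<open>z\<^sup>2 J\<^sub>C \<subseteq> I(C)\<close>. The other minimal primes are generated by
  \<open>W = {z} \<union> T\<close> with \<open>T\<close> a minimal vertex cover of \<open>E\<close>; they occur exactly if
  \<open>(W)\<close> does not contain \<open>J\<^sub>C\<close>.

  If \<open>f\<close> lies in the right hand side, it suffices to show \<open>f \<in> I(C) + (z\<^sup>2)\<close>: then
  \<open>f = i + z\<^sup>2 h\<close> with \<open>h \<in> J\<^sub>C\<close> by primality, so \<open>z\<^sup>2 h \<in> I(C)\<close>. Since \<open>I(C)\<close> is a binomial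
  ideal, this is a condition on the coefficient sums of \<open>f\<close> over the classes of monomials modulo
  \<open>I(C)\<close> that contain no multiple of \<open>z\<^sup>2\<close>. For each such class an alternating path argument
  yields a minimal cover \<open>T\<close> such that the class avoids \<open>(W)\<^sup>2\<close>; then \<open>f \<in> I(C) + (W)\<^sup>2\<close>
  makes the coefficient sum vanish. If \<open>J\<^sub>C \<subseteq> (W)\<close>, the class contains every monomial
  of \<open>f\<close> of its degree, and \<open>f \<in> J\<^sub>C\<close> suffices.\<close>

section \<open>Monomial expansions\<close>

abbreviation (input) "lookup \<equiv> Poly_Mapping.lookup"
abbreviation (input) "keys \<equiv> Poly_Mapping.keys"

abbreviation scal :: "'k \<Rightarrow> 'k::field mpoly" where
  "scal c \<equiv> Poly_Mapping.single 0 c"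

definition monomial :: "(vertex \<Rightarrow>\<^sub>0 nat) \<Rightarrow> 'k::field mpoly" where
  "monomial s = Poly_Mapping.single s 1"

abbreviation var_exp :: "vertex \<Rightarrow> (vertex \<Rightarrow>\<^sub>0 nat)" where
  "var_exp v \<equiv> Poly_Mapping.single v 1"

lemma monomial_add: "monomial (s + t) = monomial s * monomial t"
  by (simp add: monomial_def mult_single)

lemma monomial_0 [simp]: "monomial 0 = 1"
  by (simp add: monomial_def)

lemma monomial_neq_0 [simp]: "monomial s \<noteq> 0"
  by (metis monomial_def lookup_single_eq lookup_zero zero_neq_one)

lemma keys_monomial [simp]: "keys (monomial s) = {s}"
  by (simp add: monomial_def)

lemma lookup_monomial: "lookup (monomial s) t = (if s = t then 1 else 0)"
  by (simp add: monomial_def lookup_single)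

lemma indet_eq_monomial: "indet v = monomial (var_exp v)"
  by (simp add: indet_def monomial_def)

lemma poly_vars_monomial [simp]: "poly_vars (monomial s) = keys s"
  by (simp add: poly_vars_def)

lemma poly_vars_scal [simp]: "poly_vars (scal c) = {}"
  by (simp add: poly_vars_def)

lemma keys_add_nat: "keys (s + t) = keys s \<union> keys t"
  for s t :: "'a \<Rightarrow>\<^sub>0 nat"
  by (auto simp: in_keys_iff lookup_add)

lemma scal_eq_0_iff: "scal c = 0 \<longleftrightarrow> c = 0"
  by (metis lookup_single_eq lookup_zero single_zero)

lemma scal_sum: "scal (sum g A) = (\<Sum>a\<in>A. scal (g a))"
  by (induction A rule: infinite_finite_induct) (auto simp: single_add)

lemma minus_var_exp_add: "v \<in> keys s \<Longrightarrow> s - var_exp v + var_exp v = s"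
  by (intro poly_mapping_eqI) (auto simp: lookup_add lookup_minus lookup_single when_def in_keys_iff)

lemma mpoly_expand: "f = (\<Sum>s\<in>keys f. scal (lookup f s) * monomial s)"
  for f :: "'k::field mpoly"
proof (rule poly_mapping_eqI)
  fix t
  have "lookup (\<Sum>s\<in>keys f. scal (lookup f s) * monomial s) t
      = (\<Sum>s\<in>keys f. if s = t then lookup f s else 0)"
    by (simp add: lookup_sum monomial_def mult_single lookup_single when_def)
  also have "\<dots> = lookup f t"
    by (simp add: in_keys_iff)
  finally show "lookup f t = lookup (\<Sum>s\<in>keys f. scal (lookup f s) * monomial s) t" by simp
qed

text \<open>Ring homomorphisms between polynomial rings and sums of coefficients over a set of monomials
  are both of this shape.\<close>

definition lin :: "((vertex \<Rightarrow>\<^sub>0 nat) \<Rightarrow> 'k::field mpoly) \<Rightarrow> 'k mpoly \<Rightarrow> 'k mpoly" where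
  "lin \<mu> f = (\<Sum>s\<in>keys f. scal (lookup f s) * \<mu> s)"

lemma lin_superset:
  assumes "finite A" "keys f \<subseteq> A"
  shows "lin \<mu> f = (\<Sum>s\<in>A. scal (lookup f s) * \<mu> s)"
  unfolding lin_def using assms by (intro sum.mono_neutral_left) (auto simp: in_keys_iff)

lemma lin_0 [simp]: "lin \<mu> 0 = 0"
  by (simp add: lin_def)

lemma lin_add: "lin \<mu> (f + g) = lin \<mu> f + lin \<mu> g"
proof -
  let ?A = "keys f \<union> keys g"
  have "lin \<mu> (f + g) = (\<Sum>s\<in>?A. scal (lookup (f + g) s) * \<mu> s)"
    "lin \<mu> f = (\<Sum>s\<in>?A. scal (lookup f s) * \<mu> s)" "lin \<mu> g = (\<Sum>s\<in>?A. scal (lookup g s) * \<mu> s)"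
    using keys_add[of f g] by (auto intro!: lin_superset)
  then show ?thesis
    by (simp add: lookup_add single_add distrib_right sum.distrib)
qed

lemma lin_scal_mult: "lin \<mu> (scal c * f) = scal c * lin \<mu> f"
proof -
  have 1: "lookup (scal c * f) s = c * lookup f s" for s
    by (simp flip: mult_map_scale_conv_mult add: map.rep_eq when_def)
  have "keys (scal c * f) \<subseteq> keys f"
    by (auto simp: in_keys_iff 1)
  then have "lin \<mu> (scal c * f) = (\<Sum>s\<in>keys f. scal (c * lookup f s) * \<mu> s)"
    by (simp add: lin_superset[of "keys f"] 1)
  also have "\<dots> = scal c * lin \<mu> f"
    unfolding lin_def sum_distrib_left
    by (rule sum.cong) (simp_all flip: mult.assoc add: mult_single)
  finally show ?thesis .
qed

lemma lin_monomial [simp]: "lin \<mu> (monomial s) = \<mu> s"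
  by (simp add: lin_def lookup_monomial)

lemma lin_sum: "lin \<mu> (sum f A) = (\<Sum>a\<in>A. lin \<mu> (f a))"
  by (induction A rule: infinite_finite_induct) (auto simp: lin_add)

lemma lin_diff: "lin \<mu> (f - g) = lin \<mu> f - lin \<mu> g"
  using lin_add[of \<mu> "f - g" g] by simp

lemma lin_mult:
  assumes "\<And>s t. \<mu> (s + t) = \<mu> s * \<mu> t"
  shows "lin \<mu> (f * g) = lin \<mu> f * lin \<mu> g"
proof -
  have 1: "lin \<mu> (monomial s * g) = \<mu> s * lin \<mu> g" for s
  proof -
    have "monomial s * g = (\<Sum>t\<in>keys g. scal (lookup g t) * monomial (s + t))"
      by (subst mpoly_expand[of g]) (simp add: sum_distrib_left monomial_add mult_ac)
    then have "lin \<mu> (monomial s * g) = (\<Sum>t\<in>keys g. scal (lookup g t) * \<mu> (s + t))"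
      by (simp only: lin_sum lin_scal_mult lin_monomial)
    also have "\<dots> = \<mu> s * lin \<mu> g"
      unfolding lin_def by (simp add: assms sum_distrib_left mult_ac)
    finally show ?thesis .
  qed
  have "f * g = (\<Sum>s\<in>keys f. scal (lookup f s) * (monomial s * g))"
    by (subst mpoly_expand[of f]) (simp add: sum_distrib_right mult.assoc)
  then have "lin \<mu> (f * g) = (\<Sum>s\<in>keys f. scal (lookup f s) * (\<mu> s * lin \<mu> g))"
    by (simp only: lin_sum lin_scal_mult 1)
  then show ?thesis
    by (simp add: lin_def[of \<mu> f] sum_distrib_right mult.assoc)
qed

text \<open>Linearity in the left factor reduces the check to monomial multipliers.\<close>

lemma lin_mult_eq_0:
  assumes "\<And>s. lin \<mu> (monomial s * g) = 0"
  shows "lin \<mu> (h * g) = 0"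
proof -
  have "h * g = (\<Sum>s\<in>keys h. scal (lookup h s) * (monomial s * g))"
    by (subst mpoly_expand[of h]) (simp add: sum_distrib_right mult.assoc)
  then show ?thesis by (simp add: lin_sum lin_scal_mult assms)
qed

section \<open>Ideals of polynomial rings\<close>

lemma polyring_idealI:
  assumes "J \<subseteq> carrier (polyring V)" "0 \<in> J" "\<And>f g. f \<in> J \<Longrightarrow> g \<in> J \<Longrightarrow> f + g \<in> J"
    "\<And>h f. f \<in> J \<Longrightarrow> poly_vars h \<subseteq> V \<Longrightarrow> h * f \<in> J"
  shows "ideal J (polyring V :: 'k::field mpoly ring)"
proof -
  interpret cring "polyring V :: 'k mpoly ring" by (rule cring_polyring)
  have um: "- f \<in> J" if "f \<in> J" for f
    using assms(4)[OF that, of "- 1"] by simp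
  have inv: "inv\<^bsub>add_monoid (polyring V)\<^esub> f = - f" if "f \<in> J" for f
  proof -
    have "f \<in> carrier (polyring V)" using that assms(1) by blast
    then have "\<ominus>\<^bsub>polyring V\<^esub> f = - f"
      by (intro minus_equality) auto
    then show ?thesis by (simp add: a_inv_def)
  qed
  show ?thesis
  proof (rule idealI)
    show "subgroup J (add_monoid (polyring V :: 'k mpoly ring))"
      by (rule subgroup.intro) (use assms um inv in auto)
  qed (use assms ring_axioms in \<open>auto simp: mult.commute\<close>)
qed

context
  fixes J :: "'k::field mpoly set" and V
  assumes J: "ideal J (polyring V)"
begin

interpretation ideal J "polyring V :: 'k mpoly ring" by (rule J)

lemma polyring_ideal_vars: "f \<in> J \<Longrightarrow> poly_vars f \<subseteq> V"
  using a_subset by auto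

lemma polyring_ideal_0: "0 \<in> J"
  using additive_subgroup.zero_closed[OF ideal.axioms(1)[OF J]] by simp

lemma polyring_ideal_add: "f \<in> J \<Longrightarrow> g \<in> J \<Longrightarrow> f + g \<in> J"
  using additive_subgroup.a_closed[OF ideal.axioms(1)[OF J]] by simp

lemma polyring_ideal_mult: "f \<in> J \<Longrightarrow> poly_vars h \<subseteq> V \<Longrightarrow> h * f \<in> J"
  using I_l_closed[of f h] by simp

lemma polyring_ideal_uminus: "f \<in> J \<Longrightarrow> - f \<in> J"
  using polyring_ideal_mult[of f "- 1"] by simp

lemma polyring_ideal_diff: "f \<in> J \<Longrightarrow> g \<in> J \<Longrightarrow> f - g \<in> J"
  using polyring_ideal_add[of f "- g"] polyring_ideal_uminus by simp

lemma polyring_ideal_sum: "(\<And>a. a \<in> A \<Longrightarrow> f a \<in> J) \<Longrightarrow> sum f A \<in> J"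
  by (induction A rule: infinite_finite_induct) (auto intro: polyring_ideal_0 polyring_ideal_add)

lemma polyring_ideal_scal_sum:
  "(\<And>s. s \<in> A \<Longrightarrow> f s \<in> J) \<Longrightarrow> (\<Sum>s\<in>A. scal (c s) * f s) \<in> J"
  by (intro polyring_ideal_sum polyring_ideal_mult) auto

text \<open>Modulo \<open>J\<close>, the terms of a class add up to one monomial of the class with the coefficient
  sum as its coefficient.\<close>

lemma mem_ideal_by_classes:
  assumes R: "equivp R"
    and diff: "\<And>s t. s \<in> keys f \<Longrightarrow> t \<in> keys f \<Longrightarrow> R s t \<Longrightarrow> monomial s - monomial t \<in> J"
    and cls: "\<And>s. s \<in> keys f \<Longrightarrow>
      monomial s \<in> J \<or> (\<Sum>t\<in>{t \<in> keys f. R s t}. lookup f t) = 0"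
  shows "f \<in> J"
proof -
  define q where "q s = {t \<in> keys f. R s t}" for s
  have "f = (\<Sum>s\<in>keys f. scal (lookup f s) * monomial s)"
    by (rule mpoly_expand)
  also have "\<dots> = (\<Sum>Q\<in>q ` keys f.
      \<Sum>s\<in>{s \<in> keys f. q s = Q}. scal (lookup f s) * monomial s)"
    by (rule sum.image_gen) simp
  also have "\<dots> \<in> J"
  proof (rule polyring_ideal_sum)
    fix Q assume "Q \<in> q ` keys f"
    then obtain s where s: "s \<in> keys f" "Q = q s" by blast
    have "{t \<in> keys f. q t = Q} = q s"
      using R s unfolding q_def equivp_def by (auto simp: set_eq_iff)
    moreover have "(\<Sum>t\<in>q s. scal (lookup f t) * monomial t)
        = (\<Sum>t\<in>q s. scal (lookup f t) * (monomial t - monomial s)) + (\<Sum>t\<in>q s. scal (lookup f t)) * monomial s"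
      by (simp add: algebra_simps sum_subtractf sum_distrib_right sum_distrib_left)
    moreover have "(\<Sum>t\<in>q s. scal (lookup f t) * (monomial t - monomial s)) \<in> J"
      using s diff R by (intro polyring_ideal_scal_sum) (auto simp: q_def intro: equivp_symp)
    moreover have "scal (\<Sum>t\<in>q s. lookup f t) * monomial s \<in> J"
      using cls[OF s(1)] polyring_ideal_mult[of "monomial s"] polyring_ideal_0
      unfolding q_def[symmetric] by auto
    ultimately show "(\<Sum>t\<in>{t \<in> keys f. q t = Q}. scal (lookup f t) * monomial t) \<in> J"
      by (simp add: polyring_ideal_add scal_sum)
  qed
  finally show ?thesis .
qed

end

text \<open>The polynomials all of whose multiples are killed by \<open>lin \<mu>\<close> form an
  ideal, even where the kernel of \<open>lin \<mu>\<close> is only a subspace. By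
  \<open>lin_mult_eq_0\<close> this ideal contains \<open>G\<close>.\<close>

lemma lin_genideal_eq_0:
  fixes f :: "'k::field mpoly"
  assumes "G \<subseteq> carrier (polyring V)" "f \<in> Idl\<^bsub>polyring V\<^esub> G"
    and "\<And>g s. g \<in> G \<Longrightarrow> lin \<mu> (monomial s * g) = 0"
  shows "lin \<mu> f = 0"
proof -
  interpret cring "polyring V :: 'k mpoly ring" by (rule cring_polyring)
  let ?N = "{f \<in> carrier (polyring V). \<forall>h. lin \<mu> (h * f) = 0}"
  have "ideal ?N (polyring V)"
  proof (rule polyring_idealI)
    show "h * f \<in> ?N" if "f \<in> ?N" "poly_vars h \<subseteq> V" for h f
      using that poly_vars_mult[of h f] by (auto simp flip: mult.assoc)
    show "f + g \<in> ?N" if "f \<in> ?N" "g \<in> ?N" for f g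
      using that poly_vars_add[of f g] by (auto simp: distrib_left lin_add)
  qed auto
  moreover have "G \<subseteq> ?N"
    using assms(1,3) by (auto intro: lin_mult_eq_0)
  ultimately have "Idl\<^bsub>polyring V\<^esub> G \<subseteq> ?N" by (rule genideal_minimal)
  then have "f \<in> ?N" using assms(2) by blast
  then have "lin \<mu> (1 * f) = 0" by blast
  then show ?thesis by simp
qed

text \<open>A multiplicative \<open>\<mu>\<close> turns \<open>lin \<mu>\<close> into a ring
  homomorphism into polynomials, where there are no zero divisors.\<close>

lemma primeideal_lin_kernel:
  assumes "\<mu> 0 = 1" "\<And>s t. \<mu> (s + t) = \<mu> s * \<mu> t"
  shows "primeideal {f \<in> carrier (polyring V). lin \<mu> f = 0} (polyring V :: 'k::field mpoly ring)"
    (is "primeideal ?N _")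
proof (rule primeidealI)
  show "ideal ?N (polyring V)"
  proof (rule polyring_idealI)
    show "h * f \<in> ?N" if "f \<in> ?N" "poly_vars h \<subseteq> V" for h f
      using that poly_vars_mult[of h f] by (auto simp: lin_mult[of \<mu>, OF assms(2)])
    show "f + g \<in> ?N" if "f \<in> ?N" "g \<in> ?N" for f g
      using that poly_vars_add[of f g] by (auto simp: distrib_left lin_add)
  qed auto
  have "lin \<mu> 1 \<noteq> 0" using lin_monomial[of \<mu> 0] assms(1) by simp
  then have "1 \<in> carrier (polyring V) - ?N" by simp
  then show "carrier (polyring V) \<noteq> ?N" by blast
qed (auto simp: cring_polyring lin_mult[of \<mu>, OF assms(2)])

text \<open>Membership in an ideal generated by variables is decided term by term: the termwise
  condition is closed under the ideal operations, and conversely a variable of \<open>W\<close> can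
  be split off each term.\<close>

lemma mem_genideal_indet_iff:
  fixes f :: "'k::field mpoly"
  assumes "W \<subseteq> V"
  shows "f \<in> Idl\<^bsub>polyring V\<^esub> (indet ` W) \<longleftrightarrow>
    poly_vars f \<subseteq> V \<and> (\<forall>s\<in>keys f. keys s \<inter> W \<noteq> {})"
  (is "?l \<longleftrightarrow> ?r")
proof
  interpret cring "polyring V :: 'k mpoly ring" by (rule cring_polyring)
  let ?I = "{f :: 'k mpoly. poly_vars f \<subseteq> V \<and> (\<forall>s\<in>keys f. keys s \<inter> W \<noteq> {})}"
  have "ideal ?I (polyring V)"
  proof (rule polyring_idealI)
    show "h * f \<in> ?I" if "f \<in> ?I" "poly_vars h \<subseteq> V" for h f
    proof -
      have "keys s \<inter> W \<noteq> {}" if s: "s \<in> keys (h * f)" for s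
      proof -
        obtain a b where "s = a + b" "b \<in> keys f" using keys_mult[of h f] s by blast
        with \<open>f \<in> ?I\<close> show ?thesis by (auto simp: keys_add_nat)
      qed
      then show ?thesis using that poly_vars_mult[of h f] by blast
    qed
    show "f + g \<in> ?I" if "f \<in> ?I" "g \<in> ?I" for f g
      using that poly_vars_add[of f g] keys_add[of f g] by blast
  qed auto
  moreover have "indet ` W \<subseteq> ?I" using assms by (auto simp: indet_eq_monomial)
  ultimately have "Idl\<^bsub>polyring V\<^esub> (indet ` W) \<subseteq> ?I" by (rule genideal_minimal)
  then show ?r if ?l using that by blast
next
  interpret cring "polyring V :: 'k mpoly ring" by (rule cring_polyring)
  have G: "indet ` W \<subseteq> carrier (polyring V :: 'k mpoly ring)" using assms by auto
  note I = genideal_ideal[OF G]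
  assume r: ?r
  have "(monomial s :: 'k mpoly) \<in> Idl\<^bsub>polyring V\<^esub> (indet ` W)" if s: "s \<in> keys f" for s
  proof -
    obtain v where v: "v \<in> keys s" "v \<in> W" using r s by blast
    have "(monomial s :: 'k mpoly) = monomial (s - var_exp v) * indet v"
      using monomial_add[of "s - var_exp v" "var_exp v"] minus_var_exp_add[OF v(1)]
      by (simp add: indet_eq_monomial)
    moreover have "keys (s - var_exp v) \<subseteq> keys s"
      by (auto simp: in_keys_iff lookup_minus)
    then have "poly_vars (monomial (s - var_exp v) :: 'k mpoly) \<subseteq> V"
      using r s by (auto simp: poly_vars_def)
    moreover have "(indet v :: 'k mpoly) \<in> Idl\<^bsub>polyring V\<^esub> (indet ` W)"
      by (rule subsetD[OF genideal_self[OF G] imageI[OF v(2)]])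
    ultimately show ?thesis using polyring_ideal_mult[OF I, of "indet v" "monomial (s - var_exp v)"] by metis
  qed
  then have "(\<Sum>s\<in>keys f. scal (lookup f s) * monomial s) \<in> Idl\<^bsub>polyring V\<^esub> (indet ` W)"
    by (intro polyring_ideal_scal_sum[OF I])
  then show ?l by (simp only: mpoly_expand[symmetric])
qed

text \<open>The ideal is the kernel of the substitution that sets the variables of \<open>W\<close>
  to zero.\<close>

lemma primeideal_genideal_indet:
  assumes "W \<subseteq> V"
  shows "primeideal (Idl\<^bsub>polyring V\<^esub> (indet ` W)) (polyring V :: 'k::field mpoly ring)"
proof -
  define \<mu> :: "(vertex \<Rightarrow>\<^sub>0 nat) \<Rightarrow> 'k mpoly"
    where "\<mu> s = (if keys s \<inter> W = {} then monomial s else 0)" for s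
  have "lookup (lin \<mu> f) t = (if keys t \<inter> W = {} then lookup f t else 0)" for f t
  proof -
    have "lookup (lin \<mu> f) t
        = (\<Sum>s\<in>keys f. if s = t \<and> keys t \<inter> W = {} then lookup f s else 0)"
      unfolding lin_def \<mu>_def
      by (auto simp: lookup_sum monomial_def mult_single lookup_single when_def intro!: sum.cong)
    also have "\<dots> = (if keys t \<inter> W = {} then lookup f t else 0)"
      by (auto simp: in_keys_iff)
    finally show ?thesis .
  qed
  then have "lin \<mu> f = 0 \<longleftrightarrow> (\<forall>s\<in>keys f. keys s \<inter> W \<noteq> {})" for f
    unfolding poly_mapping_eq_iff fun_eq_iff by (auto simp: in_keys_iff)
  then have "Idl\<^bsub>polyring V\<^esub> (indet ` W) = {f \<in> carrier (polyring V). lin \<mu> f = 0}"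
    using mem_genideal_indet_iff[OF assms, where 'k = 'k] by auto
  moreover have "primeideal {f \<in> carrier (polyring V). lin \<mu> f = 0} (polyring V :: 'k mpoly ring)"
    by (rule primeideal_lin_kernel) (auto simp: \<mu>_def monomial_add keys_add_nat Int_Un_distrib2)
  ultimately show ?thesis by simp
qed

section \<open>Coefficient sums and weights\<close>

text \<open>Turns a coefficient sum over a class into a value of \<open>lin\<close>, so that
  \<open>lin_genideal_eq_0\<close> applies to it.\<close>

lemma lin_indicator:
  "lin (\<lambda>t. if P t then 1 else 0) f = scal (\<Sum>t\<in>{t \<in> keys f. P t}. lookup f t)"
  unfolding lin_def scal_sum by (simp add: sum.inter_filter if_distrib cong: if_cong)

lemma exponent_split_two:
  assumes "v \<in> keys s" "w \<in> keys s" "v \<noteq> w"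
  shows "s = (s - var_exp v - var_exp w) + var_exp v + var_exp w"
proof -
  have "w \<in> keys (s - var_exp v)"
    using assms by (auto simp: in_keys_iff lookup_minus lookup_single when_def)
  then have "(s - var_exp v - var_exp w) + var_exp w = s - var_exp v" by (rule minus_var_exp_add)
  then have "s - var_exp v - var_exp w + var_exp w + var_exp v = s"
    using minus_var_exp_add[OF assms(1)] by simp
  then show ?thesis by (simp only: add_ac)
qed

definition exp_weight :: "(vertex \<Rightarrow> nat) \<Rightarrow> (vertex \<Rightarrow>\<^sub>0 nat) \<Rightarrow> nat" where
  "exp_weight \<omega> s = (\<Sum>v\<in>keys s. lookup s v * \<omega> v)"

lemma exp_weight_add: "exp_weight \<omega> (s + t) = exp_weight \<omega> s + exp_weight \<omega> t"
proof -
  have *: "exp_weight \<omega> u = (\<Sum>v\<in>keys s \<union> keys t. lookup u v * \<omega> v)"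
    if "keys u \<subseteq> keys s \<union> keys t" for u
    unfolding exp_weight_def using that by (intro sum.mono_neutral_left) (auto simp: in_keys_iff)
  show ?thesis by (simp add: * keys_add_nat lookup_add distrib_right sum.distrib)
qed

lemma exp_weight_var_exp: "exp_weight \<omega> (var_exp v) = \<omega> v"
  by (simp add: exp_weight_def)

lemma exp_weight_ge: "v \<in> keys s \<Longrightarrow> \<omega> v \<le> exp_weight \<omega> s"
proof -
  assume v: "v \<in> keys s"
  then have "1 * \<omega> v \<le> lookup s v * \<omega> v" by (intro mult_le_mono1) (simp add: in_keys_iff)
  also have "\<dots> \<le> exp_weight \<omega> s"
    unfolding exp_weight_def by (rule member_le_sum) (use v in auto)
  finally show ?thesis by simp
qed

lemma genideal_empty_polyring: "Idl\<^bsub>polyring V\<^esub> {} = {0 :: 'k::field mpoly}"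
proof
  interpret cring "polyring V :: 'k mpoly ring" by (rule cring_polyring)
  show "Idl\<^bsub>polyring V\<^esub> {} \<subseteq> {0 :: 'k mpoly}"
    by (rule genideal_minimal) (use zeroideal in simp_all)
  have "ideal (Idl\<^bsub>polyring V\<^esub> {} :: 'k mpoly set) (polyring V)" by (rule genideal_ideal) simp
  then show "{0} \<subseteq> (Idl\<^bsub>polyring V\<^esub> {} :: 'k mpoly set)" using polyring_ideal_0 by blast
qed

lemma mem_polyring_set_add:
  "f \<in> A <+>\<^bsub>polyring V\<^esub> B \<longleftrightarrow> (\<exists>g\<in>A. \<exists>h\<in>B. f = g + h)" for f :: "'k::field mpoly"
  by (auto simp: set_add_def')

section \<open>The toric ideal of a set of vertices\<close>

text \<open>Exponents of the Segre parametrisation \<open>x\<^sub>i\<^sub>j \<mapsto> r\<^sub>i c\<^sub>j\<close>, where the variables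
  \<open>r\<^sub>i\<close> and \<open>c\<^sub>j\<close> are indexed by \<open>(0, i)\<close> and \<open>(1, j)\<close>.\<close>

definition segre :: "(vertex \<Rightarrow>\<^sub>0 nat) \<Rightarrow> (vertex \<Rightarrow>\<^sub>0 nat)" where
  "segre s = (\<Sum>v\<in>keys s. Poly_Mapping.single (0, fst v) (lookup s v) +
     Poly_Mapping.single (1, snd v) (lookup s v))"

lemma segre_0 [simp]: "segre 0 = 0"
  by (simp add: segre_def)

lemma segre_add: "segre (s + t) = segre s + segre t"
proof -
  have *: "segre u = (\<Sum>v\<in>keys s \<union> keys t. Poly_Mapping.single (0, fst v) (lookup u v) +
      Poly_Mapping.single (1, snd v) (lookup u v))" if "keys u \<subseteq> keys s \<union> keys t" for u
    unfolding segre_def using that by (intro sum.mono_neutral_left) (auto simp: in_keys_iff)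
  show ?thesis
    by (simp add: * keys_add_nat lookup_add single_add sum.distrib add_ac)
qed

lemma segre_sum: "segre (sum f A) = (\<Sum>a\<in>A. segre (f a))"
  by (induction A rule: infinite_finite_induct) (auto simp: segre_add)

lemma segre_var_exp [simp]: "segre (var_exp v) = var_exp (0, fst v) + var_exp (1, snd v)"
  by (simp add: segre_def)

text \<open>Exponents are natural numbers, so nothing cancels; the rows and columns met by a
  monomial can be read off its Segre image.\<close>

lemma keys_segre: "keys (segre s) = (\<lambda>v. (0, fst v)) ` keys s \<union> (\<lambda>v. (1, snd v)) ` keys s"
proof -
  have "(\<Sum>v\<in>A. f v) = 0 \<longleftrightarrow> (\<forall>v\<in>A. f v = (0::nat))" if "finite A" for A and f :: "vertex \<Rightarrow> nat"
    using that by simp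
  then have *: "lookup (segre s) w \<noteq> 0 \<longleftrightarrow> (\<exists>v\<in>keys s. w = (0, fst v) \<or> w = (1, snd v))" for w
    unfolding segre_def lookup_sum lookup_add
    by (auto simp: lookup_single when_def in_keys_iff split: if_splits)
  show ?thesis
  proof (rule Set.set_eqI)
    fix w
    show "w \<in> keys (segre s) \<longleftrightarrow> w \<in> (\<lambda>v. (0, fst v)) ` keys s \<union> (\<lambda>v. (1, snd v)) ` keys s"
      using *[of w] by (simp only: in_keys_iff[of w "segre s"]) blast
  qed
qed

lemma rows_segre: "fst ` keys s = {i. (0, i) \<in> keys (segre s)}"
  and cols_segre: "snd ` keys s = {j. (1, j) \<in> keys (segre s)}"
  unfolding keys_segre by (auto simp: image_iff)

definition segre_ideal :: "vertex set \<Rightarrow> 'k::field mpoly set" where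
  "segre_ideal V = {f \<in> carrier (polyring V). lin (\<lambda>s. monomial (segre s)) f = 0}"

lemma primeideal_segre_ideal: "primeideal (segre_ideal V :: 'k::field mpoly set) (polyring V)"
  unfolding segre_ideal_def by (rule primeideal_lin_kernel) (auto simp: segre_add monomial_add)

text \<open>The sum is the coefficient of the image of \<open>f\<close> at the monomial
  \<open>\<delta>\<close>.\<close>

lemma segre_ideal_class_sum:
  assumes "f \<in> segre_ideal V"
  shows "(\<Sum>t\<in>{t \<in> keys f. segre t = \<delta>}. lookup f t) = 0"
proof -
  have "lookup (lin (\<lambda>s. monomial (segre s)) f) \<delta> = (\<Sum>s\<in>keys f. if segre s = \<delta> then lookup f s else 0)"
    unfolding lin_def
    by (auto simp: lookup_sum monomial_def mult_single lookup_single when_def intro!: sum.cong)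
  also have "\<dots> = (\<Sum>t\<in>{t \<in> keys f. segre t = \<delta>}. lookup f t)"
    by (simp add: sum.inter_filter)
  finally show ?thesis using assms by (simp add: segre_ideal_def)
qed

lemma diff_mem_segre_ideal:
  assumes "keys s \<subseteq> V" "keys t \<subseteq> V" "segre s = segre t"
  shows "monomial s - monomial t \<in> segre_ideal V"
  using assms poly_vars_diff[of "monomial s" "monomial t"]
  by (auto simp: segre_ideal_def lin_diff)

section \<open>Cycle binomials as generators of the Segre ideal\<close>

definition cycle_binomial :: "nat \<Rightarrow> (nat \<Rightarrow> nat) \<Rightarrow> (nat \<Rightarrow> nat) \<Rightarrow> 'k::field mpoly" where
  "cycle_binomial r i j = (\<Prod>k<r. indet (i k, j k)) - (\<Prod>k<r. indet (i (Suc k mod r), j k))"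

lemma prod_indet: "(\<Prod>k\<in>A. indet (f k)) = monomial (\<Sum>k\<in>A. var_exp (f k))"
  by (induction A rule: infinite_finite_induct) (auto simp: indet_eq_monomial monomial_add)

lemma sum_rotate: "(\<Sum>k<r. f (Suc k mod r)) = (\<Sum>k<r. f k)"
  for f :: "nat \<Rightarrow> 'a::comm_monoid_add"
proof (cases r)
  case (Suc q)
  have "(\<Sum>k<Suc q. f (Suc k mod Suc q)) = (\<Sum>k<q. f (Suc k)) + f 0"
    by (simp add: mod_less)
  also have "\<dots> = (\<Sum>k<Suc q. f k)"
    by (simp only: sum.lessThan_Suc_shift add.commute)
  finally show ?thesis using Suc by simp
qed simp

text \<open>The rotation only permutes the row indices of the factors.\<close>

lemma segre_rotate:
  "segre (\<Sum>k<r. var_exp (i (Suc k mod r), j k)) = segre (\<Sum>k<r. var_exp (i k, j k))"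
  using sum_rotate[of "\<lambda>k. var_exp (0, i k)" r] by (simp add: segre_sum sum.distrib del: One_nat_def)

text \<open>An orbit in a finite set repeats a value. Starting there and taking the least positive
  period makes the iterates distinct, which later yields a cycle without repeated vertices.\<close>

lemma periodic_point_exists:
  assumes "finite R" "R \<noteq> {}" "\<And>x. x \<in> R \<Longrightarrow> N x \<in> R"
  shows "\<exists>x\<in>R. \<exists>r>0. (N ^^ r) x = x \<and> inj_on (\<lambda>k. (N ^^ k) x) {..<r}"
proof -
  obtain y where y: "y \<in> R" using assms(2) by blast
  have inR: "(N ^^ k) y \<in> R" for k by (induction k) (auto simp: y assms(3))
  have "\<not> inj (\<lambda>k. (N ^^ k) y)"
  proof
    assume "inj (\<lambda>k. (N ^^ k) y)"
    moreover have "finite (range (\<lambda>k. (N ^^ k) y))"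
      using inR by (intro finite_subset[OF _ assms(1)]) blast
    ultimately show False using finite_imageD infinite_UNIV_nat by blast
  qed
  then obtain a b where ab: "a < b" "(N ^^ a) y = (N ^^ b) y"
    unfolding inj_def by (metis linorder_neqE_nat)
  define x where "x = (N ^^ a) y"
  have "(N ^^ (b - a)) x = (N ^^ (b - a + a)) y" by (simp only: x_def funpow_add o_def)
  then have ex: "(N ^^ (b - a)) x = x" using ab by (simp add: x_def)
  define r where "r = (LEAST r. r > 0 \<and> (N ^^ r) x = x)"
  have r: "r > 0" "(N ^^ r) x = x"
    using LeastI[of "\<lambda>r. r > 0 \<and> (N ^^ r) x = x" "b - a"] ex ab(1) unfolding r_def by auto
  have less: "(N ^^ p) x \<noteq> (N ^^ q) x" if "p < q" "q < r" for p q
  proof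
    assume "(N ^^ p) x = (N ^^ q) x"
    then have "(N ^^ (r - q + p)) x = (N ^^ (r - q + q)) x" by (simp only: funpow_add o_def)
    then have "(N ^^ (r - q + p)) x = x" using r that by simp
    moreover have "r - q + p > 0" "r - q + p < r" using that by auto
    ultimately show False
      using not_less_Least[of "r - q + p" "\<lambda>r. r > 0 \<and> (N ^^ r) x = x"] unfolding r_def by blast
  qed
  then have "inj_on (\<lambda>k. (N ^^ k) x) {..<r}"
    by (intro inj_onI) (metis lessThan_iff linorder_neqE_nat)
  then show ?thesis using r inR[of a] x_def by blast
qed

lemma sum_lookup_minus_var_exp:
  assumes "v \<in> keys t"
  shows "sum (lookup (t - var_exp v)) (keys (t - var_exp v)) < sum (lookup t) (keys t)"
proof -
  have "sum (lookup (t - var_exp v)) (keys (t - var_exp v)) = sum (lookup (t - var_exp v)) (keys t)"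
    by (intro sum.mono_neutral_left) (auto simp: in_keys_iff lookup_minus)
  also have "\<dots> < sum (lookup t) (keys t)"
    using assms by (intro sum_strict_mono_ex1 bexI[of _ v])
      (auto simp: lookup_minus lookup_single in_keys_iff)
  finally show ?thesis .
qed

lemma keys_minus_nat: "keys (s - t) \<subseteq> keys s" for s t :: "'a \<Rightarrow>\<^sub>0 nat"
  by (auto simp: in_keys_iff lookup_minus)

text \<open>Two monomials of equal degree without common variable contain an alternating cycle: from
  a row go along a variable of \<open>s\<close> to a column and from there along a variable of \<open>t\<close> to the next
  row. Exchanging along the cycle creates a common variable.\<close>

lemma diff_mem_ideal_of_cycles:
  assumes J: "ideal J (polyring V)"
    and cyc: "\<And>r i j. 2 \<le> r \<Longrightarrow> inj_on i {..<r} \<Longrightarrow> inj_on j {..<r} \<Longrightarrow>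
      (\<And>k. k < r \<Longrightarrow> (i k, j k) \<in> V \<and> (i (Suc k mod r), j k) \<in> V) \<Longrightarrow> cycle_binomial r i j \<in> J"
  shows "keys s \<subseteq> V \<Longrightarrow> keys t \<subseteq> V \<Longrightarrow> segre s = segre t \<Longrightarrow>
    (monomial s - monomial t :: 'k::field mpoly) \<in> J"
proof (induction "sum (lookup t) (keys t)" arbitrary: s t rule: less_induct)
  case less
  \<comment> \<open>Cancelling a shared variable lowers the degree of \<open>t\<close>, so the
    induction hypothesis applies to the quotients.\<close>
  have common: "(monomial s' - monomial t :: 'k mpoly) \<in> J"
    if s': "keys s' \<subseteq> V" "segre s' = segre t" "v \<in> keys s'" and v: "v \<in> keys t" for s' v
  proof -
    have s'_eq: "s' - var_exp v + var_exp v = s'" and t_eq: "t - var_exp v + var_exp v = t"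
      using s'(3) v by (simp_all only: minus_var_exp_add)
    have "segre (s' - var_exp v) = segre (t - var_exp v)"
      using s'(2) segre_add[of "s' - var_exp v" "var_exp v"] segre_add[of "t - var_exp v" "var_exp v"]
      unfolding s'_eq t_eq by simp
    then have "(monomial (s' - var_exp v) - monomial (t - var_exp v) :: 'k mpoly) \<in> J"
      by (rule less.hyps[OF sum_lookup_minus_var_exp[OF v] order_trans[OF keys_minus_nat s'(1)]
            order_trans[OF keys_minus_nat less.prems(2)]])
    then have "indet v * (monomial (s' - var_exp v) - monomial (t - var_exp v)) \<in> J"
      using s' by (intro polyring_ideal_mult[OF J]) auto
    moreover have "indet v * (monomial (s' - var_exp v) - monomial (t - var_exp v))
        = (monomial s' - monomial t :: 'k mpoly)"
      using monomial_add[of "s' - var_exp v" "var_exp v", where 'a = 'k]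
        monomial_add[of "t - var_exp v" "var_exp v", where 'a = 'k]
      unfolding s'_eq t_eq by (simp add: indet_eq_monomial algebra_simps)
    ultimately show ?thesis by simp
  qed
  show ?case
  proof (cases "keys s \<inter> keys t = {}")
    case False
    then show ?thesis using common less.prems by blast
  next
    case disj: True
    show ?thesis
    proof (cases "keys s = {}")
      case True
      then have "keys t = {}" using less.prems(3) rows_segre[of s] rows_segre[of t] by simp
      then show ?thesis using True polyring_ideal_0[OF J] by simp
    next
      case False
      have "\<forall>i\<in>fst ` keys s. \<exists>j. (i, j) \<in> keys s" by force
      then obtain c where c: "\<And>i. i \<in> fst ` keys s \<Longrightarrow> (i, c i) \<in> keys s" by metis
      have "\<forall>j\<in>snd ` keys t. \<exists>i. (i, j) \<in> keys t" by force
      then obtain d where d: "\<And>j. j \<in> snd ` keys t \<Longrightarrow> (d j, j) \<in> keys t" by metis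
      define R where "R = fst ` keys s"
      \<comment> \<open>Equal Segre images give equal sets of rows and of columns, so the walk can
        always be continued.\<close>
      have cs: "c i \<in> snd ` keys t" if "i \<in> R" for i
        using c[of i] that less.prems(3) cols_segre[of s] cols_segre[of t] unfolding R_def by force
      have NR: "d (c i) \<in> R" if "i \<in> R" for i
        using d[OF cs[OF that]] less.prems(3) rows_segre[of s] rows_segre[of t] unfolding R_def by force
      have "finite R" "R \<noteq> {}" using False by (auto simp: R_def)
      then obtain x r where x: "x \<in> R" and r: "r > 0" "((\<lambda>i. d (c i)) ^^ r) x = x"
        and inj: "inj_on (\<lambda>k. ((\<lambda>i. d (c i)) ^^ k) x) {..<r}"
        using periodic_point_exists[of R "\<lambda>i. d (c i)"] NR by blast
      define i where "i k = ((\<lambda>i. d (c i)) ^^ k) x" for k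
      define j where "j k = c (i k)" for k
      have iR: "i k \<in> R" for k by (induction k) (auto simp: i_def x NR)
      have Suc_i: "i (Suc k mod r) = d (j k)" if "k < r" for k
      proof (cases "Suc k = r")
        case True
        then have "d (j k) = ((\<lambda>i. d (c i)) ^^ r) x" by (auto simp: i_def j_def)
        then show ?thesis using True r by (simp add: i_def)
      qed (use that in \<open>auto simp: i_def j_def\<close>)
      have s_mem: "(i k, j k) \<in> keys s" for k
        using c iR unfolding j_def R_def by blast
      have t_mem: "(i (Suc k mod r), j k) \<in> keys t" if "k < r" for k
        using d[OF cs[OF iR, of k]] Suc_i[OF that] by (simp add: j_def)
      have inj_i: "inj_on i {..<r}" using inj by (simp add: inj_on_def i_def)
      have inj_j: "inj_on j {..<r}"
      proof (rule inj_onI)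
        fix p q assume pq: "p \<in> {..<r}" "q \<in> {..<r}" "j p = j q"
        then have "i (Suc p mod r) = i (Suc q mod r)" using Suc_i[of p] Suc_i[of q] by simp
        then have "Suc p mod r = Suc q mod r"
          using inj_onD[OF inj_i, of "Suc p mod r" "Suc q mod r"] r(1) by simp
        then show "p = q"
          using pq(1,2) by (cases "Suc p = r"; cases "Suc q = r") auto
      qed
      \<comment> \<open>A walk closing after one round would pass through a variable common to
        \<open>s\<close> and \<open>t\<close>.\<close>
      have "r \<noteq> 1"
      proof
        assume "r = 1"
        then show False using s_mem[of 0] t_mem[of 0] disj by auto
      qed
      then have "2 \<le> r" using r(1) by simp
      define U U' where "U = (\<Sum>k<r. var_exp (i k, j k))"
        and "U' = (\<Sum>k<r. var_exp (i (Suc k mod r), j k))"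
      have "(monomial U - monomial U' :: 'k mpoly) \<in> J"
        using cyc[OF \<open>2 \<le> r\<close> inj_i inj_j] s_mem t_mem less.prems
        unfolding cycle_binomial_def prod_indet U_def U'_def by blast
      moreover have "keys (s - U) \<subseteq> V" by (rule order_trans[OF keys_minus_nat less.prems(1)])
      ultimately have "monomial (s - U) * (monomial U - monomial U' :: 'k mpoly) \<in> J"
        by (intro polyring_ideal_mult[OF J]) auto
      \<comment> \<open>Injectivity of \<open>i\<close> bounds every exponent of \<open>U\<close> by
        one, so \<open>U\<close> divides \<open>s\<close> and the truncated difference is
        exact.\<close>
      moreover have "s - U + U = s"
      proof (rule poly_mapping_eqI)
        fix v
        have "lookup U v \<le> lookup s v"
        proof (cases "\<exists>p<r. v = (i p, j p)")
          case True
          then obtain p where p: "p < r" "v = (i p, j p)" by blast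
          have "lookup U v = (\<Sum>k<r. if k = p then 1 else 0)"
            unfolding U_def lookup_sum using p inj_i
            by (intro sum.cong) (auto simp: lookup_single when_def inj_on_def)
          also have "\<dots> = 1" using p by simp
          finally show ?thesis using s_mem[of p] p by (auto simp: in_keys_iff)
        next
          case False
          then have "lookup U v = 0"
            unfolding U_def lookup_sum by (intro sum.neutral) (auto simp: lookup_single when_def)
          then show ?thesis by simp
        qed
        then show "lookup (s - U + U) v = lookup s v" by (simp add: lookup_add lookup_minus)
      qed
      \<comment> \<open>After the exchange the variable at \<open>(i (Suc 0 mod r), j 0)\<close> is
        shared with \<open>t\<close>, so \<open>common\<close> applies.\<close>
      moreover have "(monomial (s - U + U') - monomial t :: 'k mpoly) \<in> J"
      proof (rule common)
        have "lookup U' v = 0" if "v \<notin> V" for v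
          unfolding U'_def lookup_sum using t_mem less.prems(2) that
          by (intro sum.neutral) (auto simp: lookup_single when_def)
        then have "keys U' \<subseteq> V" by (auto simp: in_keys_iff)
        then show "keys (s - U + U') \<subseteq> V"
          using \<open>keys (s - U) \<subseteq> V\<close> by (simp add: keys_add_nat)
        have "segre (s - U + U') = segre (s - U + U)"
          using segre_rotate[of i r j] by (simp add: segre_add U_def U'_def)
        then show "segre (s - U + U') = segre t" using \<open>s - U + U = s\<close> less.prems(3) by simp
        show "(i (Suc 0 mod r), j 0) \<in> keys t" using t_mem[of 0] r(1) by simp
        have "(\<Sum>k<r. lookup (var_exp (i (Suc k mod r), j k)) (i (Suc 0 mod r), j 0)) \<noteq> 0"
          using r(1) by (auto simp: lookup_single intro!: bexI[of _ 0])
        then show "(i (Suc 0 mod r), j 0) \<in> keys (s - U + U')"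
          by (simp add: in_keys_iff lookup_add U'_def lookup_sum)
      qed
      ultimately have sum_mem: "monomial (s - U) * (monomial U - monomial U' :: 'k mpoly) +
          (monomial (s - U + U') - monomial t) \<in> J" and s_eq: "s - U + U = s"
        using polyring_ideal_add[OF J] by blast+
      have "monomial (s - U) * (monomial U - monomial U' :: 'k mpoly) +
          (monomial (s - U + U') - monomial t) = monomial (s - U + U) - monomial t"
        unfolding monomial_add by (simp add: algebra_simps)
      then show ?thesis using sum_mem unfolding s_eq by metis
    qed
  qed
qed

text \<open>The fibres of \<open>segre\<close> serve as classes: monomials in one fibre are
  congruent modulo \<open>J\<close>, and the coefficients of \<open>f\<close> sum to zero over each
  fibre.\<close>

lemma segre_ideal_subset_ideal_of_cycles:
  assumes J: "ideal (J :: 'k::field mpoly set) (polyring V)"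
    and cyc: "\<And>r i j. 2 \<le> r \<Longrightarrow> inj_on i {..<r} \<Longrightarrow> inj_on j {..<r} \<Longrightarrow>
      (\<And>k. k < r \<Longrightarrow> (i k, j k) \<in> V \<and> (i (Suc k mod r), j k) \<in> V) \<Longrightarrow> cycle_binomial r i j \<in> J"
  shows "segre_ideal V \<subseteq> J"
proof
  fix f :: "'k mpoly" assume f: "f \<in> segre_ideal V"
  then have keys: "keys s \<subseteq> V" if "s \<in> keys f" for s
    using that by (auto simp: segre_ideal_def poly_vars_def)
  show "f \<in> J"
  proof (rule mem_ideal_by_classes[OF J, where R = "\<lambda>s t. segre t = segre s"])
    show "equivp (\<lambda>s t. segre t = segre s)" by (auto simp: equivp_def fun_eq_iff)
    show "monomial s - monomial t \<in> J" if "s \<in> keys f" "t \<in> keys f" "segre t = segre s" for s t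
      using that keys by (intro diff_mem_ideal_of_cycles[OF J cyc]) auto
    show "monomial s \<in> J \<or> (\<Sum>t\<in>{t \<in> keys f. segre t = segre s}. lookup f t) = 0" for s
      using segre_ideal_class_sum[OF f] by blast
  qed
qed

lemma cycle_binomial_mem_segre_ideal:
  assumes "\<And>k. k < r \<Longrightarrow> (i k, j k) \<in> V \<and> (i (Suc k mod r), j k) \<in> V"
  shows "cycle_binomial r i j \<in> segre_ideal V"
proof -
  have "keys (\<Sum>k<r. var_exp (f k)) \<subseteq> V" if "\<And>k. k < r \<Longrightarrow> f k \<in> V" for f
  proof
    fix v assume "v \<in> keys (\<Sum>k<r. var_exp (f k))"
    then have "(\<Sum>k<r. lookup (var_exp (f k)) v) \<noteq> 0" by (simp add: in_keys_iff lookup_sum)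
    then obtain k where "k < r" "lookup (var_exp (f k)) v \<noteq> 0" by (meson lessThan_iff sum.neutral)
    then show "v \<in> V" using that by (auto simp: lookup_single when_def split: if_splits)
  qed
  then show ?thesis
    unfolding cycle_binomial_def prod_indet using assms
    by (intro diff_mem_segre_ideal) (auto simp: segre_rotate simp del: One_nat_def)
qed

section \<open>Cycles in the interval graph\<close>

text \<open>Passes from intervals to row and column numbers. An interval lies in a single row or
  column, so any of its vertices supplies the number.\<close>

lemma interval_cycle_index:
  assumes "interval_cycle D hs vs"
  shows "\<exists>i j. (\<forall>k<length hs. (i k, j k) \<in> vertices D \<and> (i (Suc k mod length hs), j k) \<in> vertices D) \<and>
    (cycle_poly hs vs :: 'k::field mpoly) = cycle_binomial (length hs) i j"
proof -
  define row :: "vertex set \<Rightarrow> nat" where "row H = fst (SOME x. x \<in> H)" for H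
  define col :: "vertex set \<Rightarrow> nat" where "col V = snd (SOME x. x \<in> V)" for V
  have meet: "H \<inter> V = {(row H, col V)} \<and> (row H, col V) \<in> vertices D"
    if e: "{Inl H, Inr V} \<in> interval_graph_edges D" for H V
  proof -
    obtain x where x: "x \<in> vertices D" "H \<inter> V = {x}" using interval_graph_edge_meet[OF e] by blast
    have "horizontal_interval D H" "vertical_interval D V"
      using e unfolding interval_graph_edges_def interval_graph_verts_def
        max_horizontal_intervals_def max_vertical_intervals_def
      by (auto simp: doubleton_eq_iff)
    then obtain a b where "\<And>y. y \<in> H \<Longrightarrow> fst y = a" "\<And>y. y \<in> V \<Longrightarrow> snd y = b"
      unfolding horizontal_interval_def vertical_interval_def by blast
    moreover have "x \<in> H" "x \<in> V" using x by auto
    then have "(SOME y. y \<in> H) \<in> H" "(SOME y. y \<in> V) \<in> V" by (metis someI)+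
    ultimately have "x = (row H, col V)"
      using \<open>x \<in> H\<close> \<open>x \<in> V\<close> unfolding row_def col_def by (metis prod.collapse)
    then show ?thesis using x by blast
  qed
  have c: "{Inl (hs ! k), Inr (vs ! k)} \<in> interval_graph_edges D"
    "{Inl (hs ! (Suc k mod length hs)), Inr (vs ! k)} \<in> interval_graph_edges D" if "k < length hs" for k
    using assms that unfolding interval_cycle_def by auto
  show ?thesis
  proof (intro exI conjI)
    show "\<forall>k<length hs. (row (hs ! k), col (vs ! k)) \<in> vertices D \<and>
        (row (hs ! (Suc k mod length hs)), col (vs ! k)) \<in> vertices D"
      using meet[OF c(1)] meet[OF c(2)] by blast
    show "cycle_poly hs vs = cycle_binomial (length hs) (\<lambda>k. row (hs ! k)) (\<lambda>k. col (vs ! k))"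
      unfolding cycle_poly_def cycle_binomial_def
      by (intro arg_cong2[where f = minus] prod.cong refl arg_cong[where f = indet])
        (use meet[OF c(1)] meet[OF c(2)] in auto)
  qed
qed

section \<open>Sets of corner minors\<close>

locale corner_minors =
  fixes C :: "minor set"
  assumes corner: "\<And>d. d \<in> C \<Longrightarrow> \<exists>a b. d = (1, a, 1, b) \<and> 2 \<le> a \<and> 2 \<le> b"
begin

abbreviation "V \<equiv> vertices C"

text \<open>A pair \<open>(a, b)\<close> plays two roles: the vertex opposite the corner of its
  minor, and an edge joining row \<open>a\<close> to column \<open>b\<close> in a bipartite
  graph.\<close>

definition E :: "(nat \<times> nat) set" where
  "E = {(a, b). (1, a, 1, b) \<in> C}"

lemma E_ge: "(a, b) \<in> E \<Longrightarrow> 2 \<le> a \<and> 2 \<le> b"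
  using corner[of "(1, a, 1, b)"] by (auto simp: E_def)

lemma C_eq: "C = (\<lambda>(a, b). (1, a, 1, b)) ` E"
proof
  show "C \<subseteq> (\<lambda>(a, b). (1, a, 1, b)) ` E"
  proof
    fix d assume d: "d \<in> C"
    then obtain a b where ab: "d = (1, a, 1, b)" using corner by blast
    then have "(a, b) \<in> E" using d by (simp add: E_def)
    then show "d \<in> (\<lambda>(a, b). (1, a, 1, b)) ` E" using ab by (intro image_eqI[of _ _ "(a, b)"]) auto
  qed
qed (auto simp: E_def)

lemma vertices_eq: "V = (\<Union>(a, b)\<in>E. {(1, 1), (1, b), (a, 1), (a, b)})"
proof -
  have "V = (\<Union>(a, b)\<in>E. minor_vertices (1, a, 1, b))"
    unfolding vertices_def by (subst C_eq) (simp add: case_prod_beta)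
  then show ?thesis by simp
qed

lemma E_vertices: "(a, b) \<in> E \<Longrightarrow> (1, 1) \<in> V \<and> (1, b) \<in> V \<and> (a, 1) \<in> V \<and> (a, b) \<in> V"
  by (auto simp: vertices_eq)

lemma vertices_cases:
  assumes "(i, j) \<in> V"
  obtains "i = 1" | "j = 1" | "(i, j) \<in> E"
  using assms by (auto simp: vertices_eq)

lemma vertices_corner: "(i, j) \<in> V \<Longrightarrow> (i, 1) \<in> V \<and> (1, j) \<in> V \<and> (1, 1) \<in> V"
  by (auto simp: vertices_eq)

text \<open>Every vertex outside column 1 has a horizontal edge to the vertex of its row in column
  1, so each row of \<open>V\<close> is a single interval.\<close>

lemma horizontal_join: "(i, j) \<in> V \<Longrightarrow> (i, j') \<in> V \<Longrightarrow> joined_by_path (hedges C) (i, j) (i, j')"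
proof -
  let ?r = "{(u, v). {u, v} \<in> hedges C}"
  have *: "((i, j), (i, 1)) \<in> ?r\<^sup>* \<and> ((i, 1), (i, j)) \<in> ?r\<^sup>*" if ij: "(i, j) \<in> V" for j
  proof (cases "j = 1")
    case False
    then obtain a b where ab: "(a, b) \<in> E" "j = b" "i = 1 \<or> i = a"
      using ij by (auto simp: vertices_eq)
    then have "{{(1, 1), (1, b)}, {(a, 1), (a, b)}} \<subseteq> hedges C"
      unfolding hedges_def E_def by force
    then have "{(i, 1), (i, j)} \<in> hedges C" using ab by auto
    then have "((i, j), (i, 1)) \<in> ?r" "((i, 1), (i, j)) \<in> ?r" by (auto simp: insert_commute)
    then show ?thesis by blast
  qed simp
  assume "(i, j) \<in> V" "(i, j') \<in> V"
  then have "((i, j), (i, j')) \<in> ?r\<^sup>*" using * rtrancl_trans by meson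
  then show ?thesis by (simp add: joined_by_path_def)
qed

lemma vertical_join: "(i, j) \<in> V \<Longrightarrow> (i', j) \<in> V \<Longrightarrow> joined_by_path (vedges C) (i, j) (i', j)"
proof -
  let ?r = "{(u, v). {u, v} \<in> vedges C}"
  have *: "((i, j), (1, j)) \<in> ?r\<^sup>* \<and> ((1, j), (i, j)) \<in> ?r\<^sup>*" if ij: "(i, j) \<in> V" for i
  proof (cases "i = 1")
    case False
    then obtain a b where ab: "(a, b) \<in> E" "i = a" "j = 1 \<or> j = b"
      using ij by (auto simp: vertices_eq)
    then have "{{(1, 1), (a, 1)}, {(1, b), (a, b)}} \<subseteq> vedges C"
      unfolding vedges_def E_def by force
    then have "{(1, j), (i, j)} \<in> vedges C" using ab by auto
    then have "((i, j), (1, j)) \<in> ?r" "((1, j), (i, j)) \<in> ?r" by (auto simp: insert_commute)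
    then show ?thesis by blast
  qed simp
  assume "(i, j) \<in> V" "(i', j) \<in> V"
  then have "((i, j), (i', j)) \<in> ?r\<^sup>*" using * rtrancl_trans by meson
  then show ?thesis by (simp add: joined_by_path_def)
qed

definition row_interval :: "nat \<Rightarrow> vertex set" where
  "row_interval i = {v \<in> V. fst v = i}"

definition col_interval :: "nat \<Rightarrow> vertex set" where
  "col_interval j = {v \<in> V. snd v = j}"

lemma row_interval_maximal:
  assumes "(i, j) \<in> V"
  shows "row_interval i \<in> max_horizontal_intervals C"
proof -
  have "row_interval i \<noteq> {}" "row_interval i \<subseteq> V" using assms by (auto simp: row_interval_def)
  then have "horizontal_interval C (row_interval i)"
    unfolding horizontal_interval_def row_interval_def using horizontal_join by auto
  moreover have "\<not> row_interval i \<subset> B" if B: "horizontal_interval C B" for B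
  proof
    assume sub: "row_interval i \<subset> B"
    obtain a where a: "\<forall>x\<in>B. fst x = a" "B \<subseteq> V" using B unfolding horizontal_interval_def by blast
    have "(i, j) \<in> B" using assms psubset_imp_subset[OF sub] by (auto simp: row_interval_def)
    then have "a = i" using a(1) by fastforce
    then show False using a sub by (auto simp: row_interval_def)
  qed
  ultimately show ?thesis unfolding max_horizontal_intervals_def by blast
qed

lemma col_interval_maximal:
  assumes "(i, j) \<in> V"
  shows "col_interval j \<in> max_vertical_intervals C"
proof -
  have "col_interval j \<noteq> {}" "col_interval j \<subseteq> V" using assms by (auto simp: col_interval_def)
  then have "vertical_interval C (col_interval j)"
    unfolding vertical_interval_def col_interval_def using vertical_join by auto
  moreover have "\<not> col_interval j \<subset> B" if B: "vertical_interval C B" for B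
  proof
    assume sub: "col_interval j \<subset> B"
    obtain a where a: "\<forall>x\<in>B. snd x = a" "B \<subseteq> V" using B unfolding vertical_interval_def by blast
    have "(i, j) \<in> B" using assms psubset_imp_subset[OF sub] by (auto simp: col_interval_def)
    then have "a = j" using a(1) by fastforce
    then show False using a sub by (auto simp: col_interval_def)
  qed
  ultimately show ?thesis unfolding max_vertical_intervals_def by blast
qed

lemma row_col_interval_edge:
  assumes "(i, j) \<in> V"
  shows "{Inl (row_interval i), Inr (col_interval j)} \<in> interval_graph_edges C"
    and "the_elem (row_interval i \<inter> col_interval j) = (i, j)"
proof -
  have "row_interval i \<inter> col_interval j = {(i, j)}"
    using assms by (auto simp: row_interval_def col_interval_def)
  moreover from this show "the_elem (row_interval i \<inter> col_interval j) = (i, j)" by simp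
  ultimately show "{Inl (row_interval i), Inr (col_interval j)} \<in> interval_graph_edges C"
    using row_interval_maximal[OF assms] col_interval_maximal[OF assms]
    unfolding interval_graph_edges_def interval_graph_verts_def by blast
qed

text \<open>Converse to \<open>interval_cycle_index\<close>: a nonempty full row or column
  determines its number, so distinct numbers give distinct intervals.\<close>

lemma interval_cycle_of_index:
  assumes r: "2 \<le> r" and inj: "inj_on i {..<r}" "inj_on j {..<r}"
    and V: "\<And>k. k < r \<Longrightarrow> (i k, j k) \<in> V \<and> (i (Suc k mod r), j k) \<in> V"
  shows "\<exists>hs vs. interval_cycle C hs vs \<and> (cycle_poly hs vs :: 'k::field mpoly) = cycle_binomial r i j"
proof (intro exI conjI)
  let ?hs = "map (\<lambda>k. row_interval (i k)) [0..<r]" and ?vs = "map (\<lambda>k. col_interval (j k)) [0..<r]"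
  have nth: "?hs ! (Suc k mod r) = row_interval (i (Suc k mod r))" if "k < r" for k
    using that by simp
  have "inj_on (\<lambda>k. row_interval (i k)) {0..<r}"
  proof (rule inj_onI)
    fix p q assume "p \<in> {0..<r}" "q \<in> {0..<r}" "row_interval (i p) = row_interval (i q)"
    moreover from this have "(i p, j p) \<in> row_interval (i q)" using V[of p] by (auto simp: row_interval_def)
    ultimately show "p = q" using inj(1) by (auto simp: row_interval_def inj_on_def)
  qed
  moreover have "inj_on (\<lambda>k. col_interval (j k)) {0..<r}"
  proof (rule inj_onI)
    fix p q assume "p \<in> {0..<r}" "q \<in> {0..<r}" "col_interval (j p) = col_interval (j q)"
    moreover from this have "(i p, j p) \<in> col_interval (j q)" using V[of p] by (auto simp: col_interval_def)
    ultimately show "p = q" using inj(2) by (auto simp: col_interval_def inj_on_def)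
  qed
  ultimately show "interval_cycle C ?hs ?vs"
    unfolding interval_cycle_def using r V row_col_interval_edge(1)
    by (auto simp: distinct_map nth)
  show "cycle_poly ?hs ?vs = (cycle_binomial r i j :: 'k mpoly)"
    unfolding cycle_poly_def cycle_binomial_def
    using r V row_col_interval_edge(2)
    by (intro arg_cong2[where f = minus] prod.cong refl arg_cong[where f = indet]) (auto simp: nth)
qed

section \<open>The ideals \<open>I\<close> and \<open>J\<close>, and the multiplier carrying
  \<open>J\<close> into \<open>I\<close>\<close>

abbreviation S :: "'k::field mpoly ring" where "S \<equiv> polyring V"
abbreviation I :: "'k::field mpoly set" where "I \<equiv> minor_ideal C"
abbreviation J :: "'k::field mpoly set" where "J \<equiv> cycle_ideal C C"

lemma minor_gens_carrier: "minor_poly ` C \<subseteq> carrier (S :: 'k::field mpoly ring)"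
  by (rule image_subsetI) (rule minor_poly_in_carrier[unfolded coord_ring_def])

lemma cycle_gens_carrier:
  "{cycle_poly hs vs | hs vs. interval_cycle C hs vs} \<subseteq> carrier (S :: 'k::field mpoly ring)"
  using cycle_poly_in_carrier[OF subset_refl] by (auto simp: coord_ring_def)

lemma ideal_I: "ideal (I :: 'k::field mpoly set) S"
proof -
  interpret cring "S :: 'k mpoly ring" by (rule cring_polyring)
  show ?thesis
    unfolding minor_ideal_def coord_ring_def by (rule genideal_ideal[OF minor_gens_carrier])
qed

lemma ideal_J: "ideal (J :: 'k::field mpoly set) S"
proof -
  interpret cring "S :: 'k mpoly ring" by (rule cring_polyring)
  show ?thesis
    unfolding cycle_ideal_def coord_ring_def by (rule genideal_ideal[OF cycle_gens_carrier])
qed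

lemma I_subset: "ideal P (S :: 'k::field mpoly ring) \<Longrightarrow> minor_poly ` C \<subseteq> P \<Longrightarrow> I \<subseteq> P"
  unfolding minor_ideal_def coord_ring_def
  by (rule ring.genideal_minimal) (auto simp: cring_polyring cring.axioms(1))

lemma J_subset: "ideal P (S :: 'k::field mpoly ring) \<Longrightarrow>
    (\<And>hs vs. interval_cycle C hs vs \<Longrightarrow> cycle_poly hs vs \<in> P) \<Longrightarrow> J \<subseteq> P"
  unfolding cycle_ideal_def coord_ring_def
  by (rule ring.genideal_minimal) (auto simp: cring_polyring cring.axioms(1))

text \<open>Cycle binomials vanish under the Segre map; conversely, the index cycles that suffice to
  generate the kernel all come from interval cycles of \<open>C\<close>.\<close>

lemma J_eq_segre_ideal: "(J :: 'k::field mpoly set) = segre_ideal V"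
proof
  show "J \<subseteq> (segre_ideal V :: 'k mpoly set)"
  proof (rule J_subset)
    show "ideal (segre_ideal V :: 'k mpoly set) S"
      using primeideal_segre_ideal primeideal.axioms(1) by blast
    fix hs vs assume "interval_cycle C hs vs"
    then obtain i j where "\<And>k. k < length hs \<Longrightarrow> (i k, j k) \<in> V \<and> (i (Suc k mod length hs), j k) \<in> V"
      "(cycle_poly hs vs :: 'k mpoly) = cycle_binomial (length hs) i j"
      using interval_cycle_index[where 'k = 'k] by blast
    then show "(cycle_poly hs vs :: 'k mpoly) \<in> segre_ideal V"
      using cycle_binomial_mem_segre_ideal[of "length hs" i j V] by simp
  qed
  show "segre_ideal V \<subseteq> (J :: 'k mpoly set)"
  proof (rule segre_ideal_subset_ideal_of_cycles[OF ideal_J])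
    interpret cring "S :: 'k mpoly ring" by (rule cring_polyring)
    fix r i j assume "2 \<le> r" "inj_on i {..<r}" "inj_on j {..<r}"
      "\<And>k. k < r \<Longrightarrow> (i k, j k) \<in> V \<and> (i (Suc k mod r), j k) \<in> V"
    then obtain hs vs where "interval_cycle C hs vs" "(cycle_poly hs vs :: 'k mpoly) = cycle_binomial r i j"
      using interval_cycle_of_index by metis
    then have "(cycle_binomial r i j :: 'k mpoly) \<in> {cycle_poly hs vs | hs vs. interval_cycle C hs vs}"
      by (metis (mono_tags, lifting) mem_Collect_eq)
    then show "(cycle_binomial r i j :: 'k mpoly) \<in> J"
      unfolding cycle_ideal_def coord_ring_def by (rule subsetD[OF genideal_self[OF cycle_gens_carrier]])
  qed
qed

lemma minor_poly_mem_I: "(a, b) \<in> E \<Longrightarrow>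
    (indet (1, 1) * indet (a, b) - indet (1, b) * indet (a, 1) :: 'k::field mpoly) \<in> I"
proof -
  interpret cring "S :: 'k mpoly ring" by (rule cring_polyring)
  assume "(a, b) \<in> E"
  then have "(1, a, 1, b) \<in> C" by (simp add: E_def)
  then have "(minor_poly (1, a, 1, b) :: 'k mpoly) \<in> minor_poly ` C" by (rule imageI)
  then have "(minor_poly (1, a, 1, b) :: 'k mpoly) \<in> I"
    unfolding minor_ideal_def coord_ring_def by (rule subsetD[OF genideal_self[OF minor_gens_carrier]])
  then show ?thesis by simp
qed

lemma I_subset_J: "(I :: 'k::field mpoly set) \<subseteq> J"
proof (rule I_subset[OF ideal_J])
  show "minor_poly ` C \<subseteq> (J :: 'k mpoly set)"
  proof (rule image_subsetI)
    fix d assume dC: "d \<in> C"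
    then obtain a b where "d = (1, a, 1, b)" using corner by blast
    then have d: "d = (1, a, 1, b)" "(a, b) \<in> E" using dC by (simp_all add: E_def)
    have "minor_poly d = (monomial (var_exp (1, 1) + var_exp (a, b)) - monomial (var_exp (1, b) + var_exp (a, 1)) :: 'k mpoly)"
      by (simp add: d indet_eq_monomial monomial_add)
    also have "\<dots> \<in> segre_ideal V"
      using E_vertices[OF d(2)]
      by (intro diff_mem_segre_ideal) (auto simp: keys_add_nat segre_add add_ac simp del: One_nat_def)
    finally show "(minor_poly d :: 'k mpoly) \<in> J" by (simp add: J_eq_segre_ideal)
  qed
qed

lemma primeideal_J: "primeideal (J :: 'k::field mpoly set) S"
  by (simp add: J_eq_segre_ideal primeideal_segre_ideal)

lemma not_mem_J: "(indet v :: 'k::field mpoly) \<notin> J"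
  by (simp add: J_eq_segre_ideal segre_ideal_def indet_eq_monomial)

text \<open>With \<open>X k = x\<^bsub>i k, 1\<^esub>\<close> and \<open>Y k = x\<^bsub>1, j k\<^esub>\<close> one has
  \<open>x\<^sub>1\<^sub>1 X k x\<^bsub>i (k+1), j k\<^esub> \<equiv> X k X (k+1) Y k \<equiv> x\<^sub>1\<^sub>1 X (k+1) x\<^bsub>i k, j k\<^esub>\<close>
  modulo the minors, which moves \<open>X\<close> once around the cycle.\<close>

lemma corner_square_mult_cycle_binomial:
  assumes r: "2 \<le> r" and V: "\<And>k. k < r \<Longrightarrow> (i k, j k) \<in> V \<and> (i (Suc k mod r), j k) \<in> V"
  shows "indet (1, 1) * indet (1, 1) * cycle_binomial r i j \<in> (I :: 'k::field mpoly set)"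
proof -
  define z :: "'k mpoly" where "z = indet (1, 1)"
  define x :: "nat \<Rightarrow> nat \<Rightarrow> 'k mpoly" where "x p q = indet (i p, j q)" for p q
  define X :: "nat \<Rightarrow> 'k mpoly" where "X k = indet (i k, 1)" for k
  define Y :: "nat \<Rightarrow> 'k mpoly" where "Y k = indet (1, j k)" for k
  \<comment> \<open>Extends the generators to every vertex: for \<open>a = 1\<close> or
    \<open>b = 1\<close> the difference is zero.\<close>
  have base: "z * indet (a, b) - indet (1, b) * indet (a, 1) \<in> I" if "(a, b) \<in> V" for a b
    using that
  proof (cases rule: vertices_cases)
    case 3
    then show ?thesis using minor_poly_mem_I unfolding z_def by blast
  qed (simp_all add: z_def polyring_ideal_0[OF ideal_I] mult.commute)
  \<comment> \<open>\<open>q\<close> is the last index, the only one at which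
    \<open>Suc k mod r\<close> wraps around to 0.\<close>
  define q where "q = r - 1"
  have rq: "r = Suc q" using r by (simp add: q_def)
  have succ: "Suc k mod r = Suc k" if "k < q" for k using that rq by simp
  have vars: "poly_vars z \<subseteq> V" "k < r \<Longrightarrow> poly_vars (X k) \<subseteq> V" "k < r \<Longrightarrow> poly_vars (Y k) \<subseteq> V"
     "k < r \<Longrightarrow> poly_vars (x k k) \<subseteq> V" "k < q \<Longrightarrow> poly_vars (x (Suc k) k) \<subseteq> V" for k
    using V[of 0] V[of k] r succ[of k] rq vertices_corner by (auto simp: z_def X_def Y_def x_def)
  note mult = polyring_ideal_mult[OF ideal_I] and diff = polyring_ideal_diff[OF ideal_I]
    and add = polyring_ideal_add[OF ideal_I]
  have step: "z * X k * x (Suc k) k - z * X (Suc k) * x k k \<in> I" if k: "k < q" for k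
  proof -
    have "X k * (z * x (Suc k) k - Y k * X (Suc k)) - X (Suc k) * (z * x k k - Y k * X k) \<in> I"
      using V[of k] k rq succ[OF k] vars
      unfolding x_def X_def Y_def by (intro diff mult base) auto
    then show ?thesis by (simp add: algebra_simps)
  qed
  have vars_prod: "poly_vars (\<Prod>k<p. f k) \<subseteq> V" if "\<And>k. k < p \<Longrightarrow> poly_vars (f k) \<subseteq> V"
    for p and f :: "nat \<Rightarrow> 'k mpoly"
    using poly_vars_prod[of f "{..<p}"] that by blast
  \<comment> \<open>Chaining the steps costs only one factor \<open>z\<close>; the second one closes
    the cycle in column \<open>j q\<close>.\<close>
  have path: "z * X 0 * (\<Prod>k<p. x (Suc k) k) - z * X p * (\<Prod>k<p. x k k) \<in> I" if "p \<le> q" for p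
    using that
  proof (induction p)
    case (Suc p)
    have "x (Suc p) p * (z * X 0 * (\<Prod>k<p. x (Suc k) k) - z * X p * (\<Prod>k<p. x k k)) +
        (\<Prod>k<p. x k k) * (z * X p * x (Suc p) p - z * X (Suc p) * x p p) \<in> I"
      using Suc rq vars by (intro add mult step vars_prod) auto
    then show ?case by (simp add: algebra_simps)
  qed (simp add: polyring_ideal_0[OF ideal_I])
  define A B where "A = (\<Prod>k<q. x k k)" and "B = (\<Prod>k<q. x (Suc k) k)"
  have vA: "poly_vars A \<subseteq> V" and vB: "poly_vars B \<subseteq> V"
    unfolding A_def B_def using rq by (auto intro!: vars_prod vars(4,5) simp del: subsetI)
  have zA: "poly_vars (z * A) \<subseteq> V" and zB: "poly_vars (z * B) \<subseteq> V"
    using vA vB vars(1) poly_vars_mult by blast+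
  have mem: "(i q, j q) \<in> V" "(i 0, j q) \<in> V" using V[of q] rq by auto
  have 1: "z * x q q - Y q * X q \<in> I" and 2: "z * x 0 q - Y q * X 0 \<in> I"
    unfolding x_def X_def Y_def by (rule base mem)+
  have 3: "z * X 0 * B - z * X q * A \<in> I" using path[of q] by (simp add: A_def B_def)
  have "poly_vars (Y q) \<subseteq> V" using vars(3)[of q] rq by simp
  \<comment> \<open>All terms containing \<open>Y q\<close> cancel in this combination, leaving
    \<open>z * z\<close> times the cycle binomial.\<close>
  note diff[OF diff[OF mult[OF 1 zA] mult[OF 2 zB]] mult[OF 3 this]]
  moreover have cyc: "cycle_binomial r i j = A * x q q - B * x 0 q"
    unfolding cycle_binomial_def A_def B_def x_def rq using succ rq by simp
  ultimately show ?thesis unfolding z_def[symmetric] cyc by (simp add: algebra_simps)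
qed

text \<open>The polynomials that the squared corner variable multiplies into \<open>I\<close> form
  an ideal, so the generators of \<open>J\<close> suffice.\<close>

lemma corner_square_mult_J:
  assumes "f \<in> (J :: 'k::field mpoly set)" "C \<noteq> {}"
  shows "indet (1, 1) * indet (1, 1) * f \<in> I"
proof -
  let ?z = "indet (1, 1) * indet (1, 1) :: 'k mpoly"
  have "E \<noteq> {}" using assms(2) by (metis C_eq image_is_empty)
  then obtain a b where "(a, b) \<in> E" by auto
  then have z: "(1, 1) \<in> V" using E_vertices by blast
  let ?Q = "{f \<in> carrier S. ?z * f \<in> I}"
  have "J \<subseteq> ?Q"
  proof (rule J_subset)
    show "ideal ?Q S"
    proof (rule polyring_idealI)
      show "h * f \<in> ?Q" if "f \<in> ?Q" "poly_vars h \<subseteq> V" for h f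
        using that poly_vars_mult[of h f] polyring_ideal_mult[OF ideal_I, of "?z * f" h]
        by (auto simp: mult_ac)
      show "f + g \<in> ?Q" if "f \<in> ?Q" "g \<in> ?Q" for f g
        using that poly_vars_add[of f g] polyring_ideal_add[OF ideal_I] by (auto simp: distrib_left)
    qed (auto simp: polyring_ideal_0[OF ideal_I])
    fix hs vs assume cyc: "interval_cycle C hs vs"
    then have "2 \<le> length hs" by (simp add: interval_cycle_def)
    obtain i j where "\<And>k. k < length hs \<Longrightarrow> (i k, j k) \<in> V \<and> (i (Suc k mod length hs), j k) \<in> V"
      "(cycle_poly hs vs :: 'k mpoly) = cycle_binomial (length hs) i j"
      using interval_cycle_index[OF cyc, where 'k = 'k] by blast
    then have "?z * cycle_poly hs vs \<in> I"
      using corner_square_mult_cycle_binomial[OF \<open>2 \<le> length hs\<close>, of i j] by simp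
    then show "cycle_poly hs vs \<in> ?Q"
      using cycle_poly_in_carrier[OF subset_refl cyc, where 'k = 'k] by (simp add: coord_ring_def)
  qed
  then show ?thesis using assms(1) by blast
qed

section \<open>Admissible sets from minimal vertex covers\<close>

text \<open>Besides the corner, \<open>W\<close> is a minimal vertex cover of the bipartite graph \<open>E\<close>, whose
  vertices are \<open>(a, 1)\<close> and \<open>(1, b)\<close>.\<close>

definition min_cover :: "vertex set \<Rightarrow> bool" where
  "min_cover W \<longleftrightarrow> (1, 1) \<in> W \<and> (\<forall>(i, j)\<in>W. i = 1 \<or> j = 1) \<and>
     (\<forall>(a, b)\<in>E. (a, 1) \<in> W \<or> (1, b) \<in> W) \<and>
     (\<forall>a. (a, 1) \<in> W \<longrightarrow> a \<noteq> 1 \<longrightarrow> (\<exists>b. (a, b) \<in> E \<and> (1, b) \<notin> W)) \<and>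
     (\<forall>b. (1, b) \<in> W \<longrightarrow> b \<noteq> 1 \<longrightarrow> (\<exists>a. (a, b) \<in> E \<and> (a, 1) \<notin> W))"

text \<open>A cover that uses no row of \<open>A\<close> other than possibly row 1: it is forced to
  contain every column adjacent to \<open>A\<close>, and then takes exactly the rows that still have
  an uncovered edge.\<close>

definition cover_avoiding :: "nat set \<Rightarrow> vertex set" where
  "cover_avoiding A = {(1, 1)} \<union> {(1, b) | b. \<exists>a\<in>A. (a, b) \<in> E} \<union>
     {(a, 1) | a. \<exists>b. (a, b) \<in> E \<and> (\<forall>a'\<in>A. (a', b) \<notin> E)}"

lemma cover_avoiding_row: "a \<noteq> 1 \<Longrightarrow>
    (a, 1) \<in> cover_avoiding A \<longleftrightarrow> (\<exists>b. (a, b) \<in> E \<and> (\<forall>a'\<in>A. (a', b) \<notin> E))"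
  by (auto simp: cover_avoiding_def)

lemma cover_avoiding_col: "b \<noteq> 1 \<Longrightarrow> (1, b) \<in> cover_avoiding A \<longleftrightarrow> (\<exists>a\<in>A. (a, b) \<in> E)"
  by (auto simp: cover_avoiding_def)

text \<open>For minimality, a chosen row has an edge to a column not adjacent to \<open>A\<close>,
  and a chosen column has an edge to a row in \<open>A\<close>; in both cases the other end is left
  out.\<close>

lemma min_cover_cover_avoiding: "min_cover (cover_avoiding A)"
proof -
  have E1: "a \<noteq> 1" "b \<noteq> 1" if "(a, b) \<in> E" for a b using E_ge[OF that] by auto
  have "(1, 1) \<in> cover_avoiding A" "\<forall>(i, j)\<in>cover_avoiding A. i = 1 \<or> j = 1"
    by (auto simp: cover_avoiding_def)
  moreover have "\<forall>(a, b)\<in>E. (a, 1) \<in> cover_avoiding A \<or> (1, b) \<in> cover_avoiding A"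
    unfolding cover_avoiding_def by auto
  moreover have "\<exists>b. (a, b) \<in> E \<and> (1, b) \<notin> cover_avoiding A"
    if "(a, 1) \<in> cover_avoiding A" "a \<noteq> 1" for a
    using that cover_avoiding_row cover_avoiding_col E1 by metis
  moreover have "\<exists>a. (a, b) \<in> E \<and> (a, 1) \<notin> cover_avoiding A"
    if b: "(1, b) \<in> cover_avoiding A" "b \<noteq> 1" for b
  proof -
    obtain a where a: "a \<in> A" "(a, b) \<in> E" using b cover_avoiding_col by blast
    then have "(a, 1) \<notin> cover_avoiding A" using cover_avoiding_row[OF E1(1)[OF a(2)]] by blast
    then show ?thesis using a by blast
  qed
  ultimately show ?thesis unfolding min_cover_def by blast
qed

section \<open>Minimal primes: \<open>J\<close> and the ideals of minimal covers\<close>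

abbreviation P :: "vertex set \<Rightarrow> 'k::field mpoly set" where
  "P W \<equiv> Idl\<^bsub>S\<^esub> (indet ` W)"

lemma corner_in_V: "C \<noteq> {} \<Longrightarrow> (1, 1) \<in> V"
proof -
  assume "C \<noteq> {}"
  then have "E \<noteq> {}" by (metis C_eq image_is_empty)
  then show ?thesis using E_vertices by auto
qed

lemma min_cover_subset_V:
  assumes "min_cover W" "C \<noteq> {}"
  shows "W \<subseteq> V"
proof
  fix v assume v: "v \<in> W"
  obtain i j where ij: "v = (i, j)" by fastforce
  have "i = 1 \<or> j = 1" using assms(1) v ij unfolding min_cover_def by blast
  then consider "v = (1, 1)" | "i = 1" "j \<noteq> 1" | "i \<noteq> 1" "j = 1" using ij by blast
  then show "v \<in> V"
  proof cases
    case 1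
    then show ?thesis using corner_in_V assms by simp
  next
    case 2
    then obtain a where "(a, j) \<in> E" using assms(1) v ij unfolding min_cover_def by blast
    then show ?thesis using E_vertices ij 2 by blast
  next
    case 3
    then obtain b where "(i, b) \<in> E" using assms(1) v ij unfolding min_cover_def by blast
    then show ?thesis using E_vertices ij 3 by blast
  qed
qed

lemma admissible_min_cover:
  assumes W: "min_cover W" and C: "C \<noteq> {}"
  shows "admissible C W"
  unfolding admissible_def
proof (intro conjI ballI)
  show "W \<subseteq> V" by (rule min_cover_subset_V[OF W C])
  fix d assume d: "d \<in> C"
  then obtain a b where ab: "d = (1, a, 1, b)" using corner by blast
  then have "(a, b) \<in> E" using d by (simp add: E_def)
  then have "(a, 1) \<in> W \<or> (1, b) \<in> W" and z: "(1, 1) \<in> W" using W unfolding min_cover_def by auto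
  then have "{(1, 1), (a, 1)} \<subseteq> W \<or> {(1, 1), (1, b)} \<subseteq> W" by blast
  then have "\<exists>e\<in>minor_edges d. e \<subseteq> W \<inter> minor_vertices d"
    unfolding ab minor_edges_def by auto
  then show "W \<inter> minor_vertices d = {} \<or> (\<exists>e\<in>minor_edges d. e \<subseteq> W \<inter> minor_vertices d)" by blast
qed

lemma cycle_ideal_empty: "cycle_ideal C {} = {0 :: 'k::field mpoly}"
proof -
  have "\<not> interval_cycle {} hs vs" for hs vs
  proof
    assume cyc: "interval_cycle {} hs vs"
    then have "0 < length hs" by (auto simp: interval_cycle_def)
    then show False using interval_cycle_index[OF cyc, where 'k = 'k] by (auto simp: vertices_def)
  qed
  then have "{cycle_poly hs vs :: 'k mpoly | hs vs. interval_cycle {} hs vs} = {}" by blast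
  then show ?thesis
    unfolding cycle_ideal_def coord_ring_def by (simp add: genideal_empty_polyring)
qed

text \<open>The corner lies in \<open>W\<close> and in every minor, so no minor remains to
  contribute cycle binomials.\<close>

lemma admissible_ideal_min_cover:
  assumes "min_cover W"
  shows "(admissible_ideal C W :: 'k::field mpoly set) = P W"
proof -
  have "minor_vertices d \<inter> W \<noteq> {}" if d: "d \<in> C" for d
  proof -
    obtain a b where "d = (1, a, 1, b)" using corner[OF d] by blast
    then show ?thesis using assms unfolding min_cover_def by auto
  qed
  then have no_minor: "{d \<in> C. minor_vertices d \<inter> W = {}} = {}" by blast
  show ?thesis
    unfolding admissible_ideal_def no_minor cycle_ideal_empty coord_ring_def
    by (auto simp: mem_polyring_set_add)
qed

lemma admissible_ideal_empty: "(admissible_ideal C {} :: 'k::field mpoly set) = J"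
  unfolding admissible_ideal_def by (auto simp: genideal_empty_polyring coord_ring_def mem_polyring_set_add)

text \<open>The squared corner variable multiplies \<open>J\<close> into \<open>I\<close>, hence
  into \<open>Q\<close>; primality cancels the corner variable twice.\<close>

lemma J_minimal:
  assumes Q: "primeideal Q (S :: 'k::field mpoly ring)" "I \<subseteq> Q" "indet (1, 1) \<notin> Q"
  shows "J \<subseteq> Q"
proof (cases "C = {}")
  case True
  then have "(J :: 'k mpoly set) = {0}" using cycle_ideal_empty by simp
  then show ?thesis using polyring_ideal_0[OF primeideal.axioms(1)[OF Q(1)]] by simp
next
  case False
  show ?thesis
  proof
    fix f :: "'k mpoly" assume f: "f \<in> J"
    interpret Q: primeideal Q "S :: 'k mpoly ring" by (rule Q(1))
    let ?z = "indet (1, 1) :: 'k mpoly"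
    have "?z * (?z * f) \<in> Q"
      using corner_square_mult_J[OF f False] Q(2) by (auto simp: mult.assoc)
    moreover have "poly_vars ?z \<subseteq> V" "poly_vars f \<subseteq> V" "poly_vars (?z * f) \<subseteq> V"
      using corner_in_V[OF False] polyring_ideal_vars[OF ideal_J f] poly_vars_mult[of ?z f] by auto
    ultimately show "f \<in> Q" using Q.I_prime[of ?z "?z * f"] Q.I_prime[of ?z f] Q(3) by auto
  qed
qed

lemma empty_minimal_admissible: "{} \<in> minimal_admissible_sets TYPE('k::field) C"
proof -
  have "minimal_prime (S :: 'k mpoly ring) I J"
    unfolding minimal_prime_def
  proof (intro conjI allI impI)
    fix Q :: "'k mpoly set" assume Q: "primeideal Q S \<and> I \<subseteq> Q \<and> Q \<subseteq> J"
    then have "indet (1, 1) \<notin> Q" using not_mem_J by blast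
    then show "Q = J" using J_minimal Q by blast
  qed (use primeideal_J I_subset_J in auto)
  then show ?thesis
    by (simp add: minimal_admissible_sets_def admissible_ideal_empty admissible_def coord_ring_def)
qed

lemma I_subset_P:
  assumes W: "min_cover W" and C: "C \<noteq> {}"
  shows "I \<subseteq> (P W :: 'k::field mpoly set)"
proof (rule I_subset)
  note WV = min_cover_subset_V[OF W C]
  show P: "ideal (P W :: 'k mpoly set) S" using primeideal_genideal_indet[OF WV] primeideal.axioms(1) by blast
  interpret cring "S :: 'k mpoly ring" by (rule cring_polyring)
  have mem: "(indet w :: 'k mpoly) \<in> P W" if "w \<in> W" for w
    using that WV by (subst mem_genideal_indet_iff) (auto simp: indet_eq_monomial)
  show "minor_poly ` C \<subseteq> (P W :: 'k mpoly set)"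
  proof (rule image_subsetI)
    fix d assume d: "d \<in> C"
    then obtain a b where ab: "d = (1, a, 1, b)" using corner by blast
    then have e: "(a, b) \<in> E" using d by (simp add: E_def)
    then have "(a, 1) \<in> W \<or> (1, b) \<in> W" "(1, 1) \<in> W" using W unfolding min_cover_def by auto
    then have "indet (1, b) * indet (a, 1) \<in> (P W :: 'k mpoly set)"
      using polyring_ideal_mult[OF P mem, of "(a, 1)" "indet (1, b)"]
        polyring_ideal_mult[OF P mem, of "(1, b)" "indet (a, 1)"] E_vertices[OF e]
      by (auto simp: mult.commute)
    moreover have "indet (a, b) * indet (1, 1) \<in> (P W :: 'k mpoly set)"
      using polyring_ideal_mult[OF P mem, of "(1, 1)" "indet (a, b)"] \<open>(1, 1) \<in> W\<close> E_vertices[OF e] by simp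
    ultimately have "indet (a, b) * indet (1, 1) - indet (1, b) * indet (a, 1) \<in> (P W :: 'k mpoly set)"
      by (intro polyring_ideal_diff[OF P])
    then show "(minor_poly d :: 'k mpoly) \<in> P W" by (simp add: ab mult.commute)
  qed
qed

text \<open>A prime \<open>Q\<close> between \<open>I\<close> and \<open>P W\<close> must contain
  the corner variable, since otherwise \<open>J \<subseteq> Q \<subseteq> P W\<close>. Each edge
  then forces one of its two end variables into \<open>Q\<close>.\<close>

lemma min_cover_minimal_admissible:
  assumes W: "min_cover W" and C: "C \<noteq> {}" and nJ: "\<not> J \<subseteq> (P W :: 'k::field mpoly set)"
  shows "W \<in> minimal_admissible_sets TYPE('k) C"
proof -
  note WV = min_cover_subset_V[OF W C]
  have "minimal_prime (S :: 'k mpoly ring) I (P W)"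
    unfolding minimal_prime_def
  proof (intro conjI allI impI)
    fix Q :: "'k mpoly set" assume Q: "primeideal Q S \<and> I \<subseteq> Q \<and> Q \<subseteq> P W"
    then interpret Q: primeideal Q "S :: 'k mpoly ring" by blast
    have notP: "(indet w :: 'k mpoly) \<notin> P W" if "w \<notin> W" for w
      using that by (subst mem_genideal_indet_iff[OF WV]) (auto simp: indet_eq_monomial)
    have z: "indet (1, 1) \<in> Q" using J_minimal[of Q] Q nJ by blast
    have edge: "indet (1, b) \<in> Q \<or> indet (a, 1) \<in> Q" if ab: "(a, b) \<in> E" for a b
    proof -
      have "indet (a, b) * indet (1, 1) \<in> Q"
        using E_vertices[OF ab] by (intro polyring_ideal_mult[OF Q.is_ideal z]) simp
      moreover have "indet (1, 1) * indet (a, b) - indet (1, b) * indet (a, 1) \<in> Q"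
        using Q minor_poly_mem_I[OF ab] by blast
      ultimately have "indet (a, b) * indet (1, 1) -
          (indet (1, 1) * indet (a, b) - indet (1, b) * indet (a, 1)) \<in> Q"
        by (rule polyring_ideal_diff[OF Q.is_ideal])
      then have "indet (1, b) * indet (a, 1) \<in> Q" by (simp add: mult.commute)
      then show ?thesis using Q.I_prime[of "indet (1, b)" "indet (a, 1)"] E_vertices[OF ab] by simp
    qed
    \<comment> \<open>Minimality of the cover gives each non-corner element an edge whose other end
      is outside \<open>W\<close>. That end variable is not in \<open>P W\<close>, hence not in
      \<open>Q\<close>.\<close>
    have "indet ` W \<subseteq> Q"
    proof (rule image_subsetI)
      fix v assume v: "v \<in> W"
      obtain i j where ij: "v = (i, j)" by fastforce
      have "i = 1 \<or> j = 1" using W v ij unfolding min_cover_def by blast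
      then consider "v = (1, 1)" | "i = 1" "j \<noteq> 1" | "i \<noteq> 1" "j = 1" using ij by blast
      then show "indet v \<in> Q"
      proof cases
        case 1
        then show ?thesis using z by simp
      next
        case 2
        then obtain a where a: "(a, j) \<in> E" "(a, 1) \<notin> W"
          using W v ij unfolding min_cover_def by blast
        then show ?thesis using edge[OF a(1)] notP[OF a(2)] Q ij 2 by blast
      next
        case 3
        then obtain b where b: "(i, b) \<in> E" "(1, b) \<notin> W"
          using W v ij unfolding min_cover_def by blast
        then show ?thesis using edge[OF b(1)] notP[OF b(2)] Q ij 3 by blast
      qed
    qed
    then have "P W \<subseteq> Q" by (intro Q.genideal_minimal Q.is_ideal)
    then show "Q = P W" using Q by blast
  qed (use primeideal_genideal_indet[OF WV] I_subset_P[OF W C] in auto)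
  then show ?thesis
    using admissible_min_cover[OF W C]
    by (simp add: minimal_admissible_sets_def admissible_ideal_min_cover[OF W] coord_ring_def)
qed

section \<open>Classes of monomials modulo the minors\<close>

text \<open>One rewriting along a generator. On monomials in the variables of \<open>V\<close>, the
  generated equivalence is congruence modulo \<open>I\<close>.\<close>

inductive minor_step :: "(vertex \<Rightarrow>\<^sub>0 nat) \<Rightarrow> (vertex \<Rightarrow>\<^sub>0 nat) \<Rightarrow> bool" where
  "(a, b) \<in> E \<Longrightarrow> minor_step (u + var_exp (1, 1) + var_exp (a, b)) (u + var_exp (1, b) + var_exp (a, 1))"

abbreviation minor_eqv (infix \<open>\<approx>\<close> 50) where "minor_eqv \<equiv> equivclp minor_step"

lemma minor_eqv_invariant:
  assumes "s \<approx> t" and "\<And>s t. minor_step s t \<Longrightarrow> g s = g t"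
  shows "g s = g t"
  using assms(1) by (induction rule: equivclp_induct) (auto dest: assms(2))

lemma segre_minor_eqv: "s \<approx> t \<Longrightarrow> segre s = segre t"
  by (erule minor_eqv_invariant, erule minor_step.cases) (simp add: segre_add add_ac del: One_nat_def)

lemma keys_minor_eqv: "s \<approx> t \<Longrightarrow> keys s \<subseteq> V \<longleftrightarrow> keys t \<subseteq> V"
  by (erule minor_eqv_invariant, erule minor_step.cases) (auto simp: keys_add_nat dest: E_vertices)

lemma diff_minor_step_mem_I:
  assumes "minor_step s t" "keys s \<subseteq> V"
  shows "(monomial s - monomial t :: 'k::field mpoly) \<in> I"
  using assms
proof cases
  case (1 a b u)
  have "poly_vars (monomial u :: 'k mpoly) \<subseteq> V" using assms(2) 1 by (simp add: keys_add_nat)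
  then have "monomial u * (indet (1, 1) * indet (a, b) - indet (1, b) * indet (a, 1)) \<in> (I :: 'k mpoly set)"
    by (intro polyring_ideal_mult[OF ideal_I] minor_poly_mem_I 1)
  then show ?thesis unfolding 1 monomial_add indet_eq_monomial by (simp only: right_diff_distrib mult.assoc)
qed

lemma diff_minor_eqv_mem_I:
  assumes "s \<approx> t" "keys s \<subseteq> V"
  shows "(monomial s - monomial t :: 'k::field mpoly) \<in> I"
  using assms(1)
proof (induction rule: equivclp_induct)
  case base
  then show ?case by (simp add: polyring_ideal_0[OF ideal_I])
next
  case (step t u)
  have "keys t \<subseteq> V" "keys u \<subseteq> V"
    using keys_minor_eqv[OF step.hyps(1)] keys_minor_eqv[OF equivclp_into_equivclp[OF step.hyps]] assms(2)
    by blast+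
  then have "(monomial t - monomial u :: 'k mpoly) \<in> I"
    using step.hyps(2) diff_minor_step_mem_I[of t u, where 'k = 'k]
      polyring_ideal_uminus[OF ideal_I diff_minor_step_mem_I[of u t, where 'k = 'k]] by auto
  from polyring_ideal_add[OF ideal_I step.IH this] show ?case by simp
qed

text \<open>A monomial multiple of a generator is a difference of two monomials of the same class,
  so its coefficient sum over any class is zero.\<close>

lemma minor_eqv_class_sum_I:
  assumes "f \<in> (I :: 'k::field mpoly set)"
  shows "(\<Sum>t\<in>{t \<in> keys f. s \<approx> t}. lookup f t) = 0"
proof -
  let ?\<mu> = "\<lambda>t. if s \<approx> t then 1 else 0 :: 'k mpoly"
  have "lin ?\<mu> f = 0"
  proof (rule lin_genideal_eq_0)
    show "minor_poly ` C \<subseteq> carrier (S :: 'k mpoly ring)" by (rule minor_gens_carrier)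
    show "f \<in> Idl\<^bsub>S\<^esub> (minor_poly ` C)" using assms by (simp add: minor_ideal_def coord_ring_def)
    fix g :: "'k mpoly" and u
    assume "g \<in> minor_poly ` C"
    then obtain d where d: "d \<in> C" "g = minor_poly d" by blast
    obtain a b where ab: "d = (1, a, 1, b)" using corner[OF d(1)] by blast
    then have "(a, b) \<in> E" using d by (simp add: E_def)
    then have "minor_step (u + var_exp (1, 1) + var_exp (a, b)) (u + var_exp (1, b) + var_exp (a, 1))"
      by (rule minor_step.intros)
    then have "s \<approx> u + var_exp (1, 1) + var_exp (a, b) \<longleftrightarrow> s \<approx> u + var_exp (1, b) + var_exp (a, 1)"
      using equivclp_into_equivclp[of minor_step s] by blast
    moreover have "monomial u * g =
        monomial (u + var_exp (1, 1) + var_exp (a, b)) - monomial (u + var_exp (1, b) + var_exp (a, 1))"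
      unfolding d(2) ab minor_poly.simps monomial_add indet_eq_monomial
      by (simp only: right_diff_distrib mult.assoc)
    ultimately show "lin ?\<mu> (monomial u * g) = 0" by (simp add: lin_diff)
  qed
  then show ?thesis by (simp only: lin_indicator scal_eq_0_iff)
qed

text \<open>A grading for which the minors are homogeneous, given a vertex cover: \<open>x\<^sub>a\<^sub>b\<close> has the
  degree of \<open>x\<^sub>1\<^sub>b x\<^sub>a\<^sub>1 / x\<^sub>1\<^sub>1\<close>. A monomial of weight one cannot be moved into the square of
  the ideal generated by \<open>W\<close>.\<close>

definition cover_weight :: "vertex set \<Rightarrow> vertex \<Rightarrow> nat" where
  "cover_weight W v =
     (if v \<in> W \<or> v \<in> E \<and> (fst v, 1) \<in> W \<and> (1, snd v) \<in> W then 1 else 0)"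

lemma exp_weight_minor_eqv:
  assumes W: "min_cover W" and "s \<approx> t"
  shows "exp_weight (cover_weight W) s = exp_weight (cover_weight W) t"
  using assms(2)
proof (rule minor_eqv_invariant)
  fix s t assume "minor_step s t"
  then show "exp_weight (cover_weight W) s = exp_weight (cover_weight W) t"
  proof cases
    case (1 a b u)
    have ab: "2 \<le> a" "2 \<le> b" using E_ge 1 by auto
    have "(a, b) \<notin> W"
    proof
      assume "(a, b) \<in> W"
      then have "a = 1 \<or> b = 1" using W unfolding min_cover_def by blast
      then show False using ab by auto
    qed
    moreover have "(a, 1) \<notin> E" "(1, b) \<notin> E" "(1, 1) \<notin> E"
      using E_ge[of a 1] E_ge[of 1 b] E_ge[of 1 1] by auto
    moreover have "(1, 1) \<in> W" "(a, 1) \<in> W \<or> (1, b) \<in> W" using W 1 unfolding min_cover_def by auto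
    \<comment> \<open>The corner has weight one, and \<open>(a, b)\<close> has weight one exactly if
      both ends of the edge are in \<open>W\<close>; so both sides are 1 or both are 2.\<close>
    ultimately have "cover_weight W (1, 1) + cover_weight W (a, b) = cover_weight W (1, b) + cover_weight W (a, 1)"
      using 1 by (auto simp: cover_weight_def)
    then show ?thesis unfolding 1 exp_weight_add exp_weight_var_exp by simp
  qed
qed

text \<open>Every term of an element of \<open>P W\<close> contains a variable of \<open>W\<close>
  and so has weight at least one; weights add up in products.\<close>

lemma exp_weight_P_square:
  assumes WV: "W \<subseteq> V" and "f \<in> P W \<cdot>\<^bsub>S\<^esub> (P W :: 'k::field mpoly set)" and "s \<in> keys f"
  shows "2 \<le> exp_weight (cover_weight W) s"
  using assms(2,3)
proof (induction arbitrary: s rule: ideal_prod.induct)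
  case (prod f g)
  have 1: "1 \<le> exp_weight (cover_weight W) u" if u: "u \<in> keys h" "h \<in> (P W :: 'k mpoly set)" for u h
  proof -
    obtain v where v: "v \<in> keys u" "v \<in> W" using u mem_genideal_indet_iff[OF WV] by blast
    then show ?thesis using exp_weight_ge[OF v(1), of "cover_weight W"] by (simp add: cover_weight_def)
  qed
  obtain a b where "a \<in> keys f" "b \<in> keys g" "s = a + b"
    using prod keys_mult[of f g] by auto
  then show ?case using 1[of a f] 1[of b g] prod by (simp add: exp_weight_add)
next
  case (sum f g)
  then show ?case using Poly_Mapping.keys_add[of f g] by auto
qed

text \<open>The summand in \<open>I\<close> has coefficient sum zero over the class, and the summand
  in the square has no term there because its terms have weight at least two.\<close>

lemma class_sum_I_add_P_square:
  assumes W: "min_cover W" "W \<subseteq> V"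
    and f: "f \<in> I <+>\<^bsub>S\<^esub> (P W \<cdot>\<^bsub>S\<^esub> (P W :: 'k::field mpoly set))"
    and s: "exp_weight (cover_weight W) s = 1"
  shows "(\<Sum>t\<in>{t \<in> keys f. s \<approx> t}. lookup f t) = 0"
proof -
  let ?\<mu> = "\<lambda>t. if s \<approx> t then 1 else 0 :: 'k mpoly"
  obtain i q where iq: "i \<in> (I :: 'k mpoly set)" "q \<in> P W \<cdot>\<^bsub>S\<^esub> (P W :: 'k mpoly set)" "f = i + q"
    using f by (auto simp: mem_polyring_set_add)
  have "\<not> s \<approx> t" if "t \<in> keys q" for t
    using exp_weight_P_square[OF W(2) iq(2) that] exp_weight_minor_eqv[OF W(1), of s t] s by auto
  then have empty: "{t \<in> keys q. s \<approx> t} = {}" by blast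
  have "lin ?\<mu> i = 0" "lin ?\<mu> q = 0"
    unfolding lin_indicator minor_eqv_class_sum_I[OF iq(1)] empty by simp_all
  then have "lin ?\<mu> f = 0" unfolding iq(3) lin_add by simp
  then show ?thesis by (simp only: lin_indicator scal_eq_0_iff)
qed

section \<open>Choosing the cover\<close>

text \<open>Tests \<open>f\<close> against the cover avoiding all rows \<open>a\<close> whose
  variable at \<open>(a, 1)\<close> divides \<open>s\<close>. A variable of \<open>s\<close> in that
  cover is the corner or lies in a column adjacent to such a row.\<close>

lemma corner_or_edge:
  assumes f: "\<And>W. min_cover W \<Longrightarrow> f \<in> (P W :: 'k::field mpoly set)" and C: "C \<noteq> {}"
    and s: "s \<in> keys f"
  shows "(1, 1) \<in> keys s \<or> (\<exists>(a, b)\<in>E. (a, 1) \<in> keys s \<and> (1, b) \<in> keys s)"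
proof -
  let ?A = "{a. (a, 1) \<in> keys s}"
  have W: "min_cover (cover_avoiding ?A)" by (rule min_cover_cover_avoiding)
  obtain v where v: "v \<in> keys s" "v \<in> cover_avoiding ?A"
    using f[OF W] s mem_genideal_indet_iff[OF min_cover_subset_V[OF W C]] by blast
  then show ?thesis unfolding cover_avoiding_def by auto
qed

text \<open>In the second case a backward \<open>minor_step\<close> creates the corner
  variable.\<close>

lemma corner_in_class:
  assumes "(1, 1) \<in> keys s \<or> (\<exists>(a, b)\<in>E. (a, 1) \<in> keys s \<and> (1, b) \<in> keys s)"
  shows "\<exists>t. s \<approx> t \<and> (1, 1) \<in> keys t"
proof (cases "(1, 1) \<in> keys s")
  case True
  then show ?thesis by (intro exI[of _ s]) simp
next
  case False
  then obtain a b where ab: "(a, b) \<in> E" "(a, 1) \<in> keys s" "(1, b) \<in> keys s" using assms by blast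
  then have "s = (s - var_exp (1, b) - var_exp (a, 1)) + var_exp (1, b) + var_exp (a, 1)"
    using E_ge[OF ab(1)] by (intro exponent_split_two) auto
  moreover obtain u where u: "u = s - var_exp (1, b) - var_exp (a, 1)" by blast
  ultimately have "u + var_exp (1, 1) + var_exp (a, b) \<approx> s"
    using minor_step.intros[OF ab(1), of u] by (metis r_into_equivclp)
  moreover have "(1, 1) \<in> keys (u + var_exp (1, 1) + var_exp (a, b))" by (simp add: keys_add_nat)
  ultimately show ?thesis by (metis equivclp_sym)
qed

text \<open>A pair \<open>(a', a)\<close> means that a row variable can move from row
  \<open>a'\<close> to row \<open>a\<close>, consuming a vertex \<open>(a, b)\<close> of
  \<open>F\<close> and producing \<open>(a', b)\<close>.\<close>

definition slide :: "vertex set \<Rightarrow> (nat \<times> nat) set" where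
  "slide F = {(a', a). \<exists>b. (a', b) \<in> E \<and> (a, b) \<in> F}"

text \<open>Modulo the minors, \<open>x\<^sub>1\<^sub>1 x\<^bsub>a', 1\<^esub> x\<^bsub>a, b\<^esub> \<equiv> x\<^sub>1\<^sub>1 x\<^bsub>a, 1\<^esub> x\<^bsub>a', b\<^esub>\<close> for \<open>(a', b) \<in> E\<close>.
  Walking along a path of such moves that does not return to a row, every move finds
  its variable \<open>x\<^bsub>a, b\<^esub>\<close> still in place.\<close>

lemma slide_reachable:
  assumes "(a0, a) \<in> (slide F)\<^sup>*" "F \<subseteq> keys s \<inter> E" "(1, 1) \<in> keys s" "(a0, 1) \<in> keys s" "a0 \<noteq> 1"
  shows "\<exists>t. s \<approx> t \<and> (1, 1) \<in> keys t \<and> (a, 1) \<in> keys t \<and> (\<forall>b. (1, b) \<in> keys s \<longrightarrow> (1, b) \<in> keys t)"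
  using assms
proof (induction "card F" arbitrary: F s a0 rule: less_induct)
  case less
  show ?case
  proof (cases "a0 = a")
    case True
    then show ?thesis using less.prems by (intro exI[of _ s]) simp
  next
    case False
    then obtain a1 where a1: "(a0, a1) \<in> slide F" "(a1, a) \<in> (slide F)\<^sup>*"
      using less.prems(1) by (auto elim: converse_rtranclE)
    then obtain b where b: "(a0, b) \<in> E" "(a1, b) \<in> F" unfolding slide_def by blast
    have a1b: "(a1, b) \<in> keys s" "(a1, b) \<in> E" using b less.prems(2) by auto
    have ge: "2 \<le> a0" "2 \<le> b" "2 \<le> a1" using E_ge[OF b(1)] E_ge[OF a1b(2)] by auto
    define F' where "F' = {v \<in> F. fst v \<noteq> a1}"
    have "finite F" by (rule finite_subset[of F "keys s"]) (use less.prems(2) in auto)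
    moreover have "F' \<subseteq> F" "(a1, b) \<notin> F'" by (auto simp: F'_def)
    ultimately have card: "card F' < card F"
      using b(2) by (intro psubset_card_mono) blast+
    \<comment> \<open>Whenever the path returns to \<open>a1\<close> it is restarted there, so the
      remaining moves consume no vertex of row \<open>a1\<close>.\<close>
    have "(a1, x) \<in> (slide F')\<^sup>*" if "(a1, x) \<in> (slide F)\<^sup>*" for x
      using that
    proof (induction rule: rtrancl_induct)
      case (step y x)
      show ?case
      proof (cases "x = a1")
        case False
        then have "(y, x) \<in> slide F'" using step.hyps(2) by (auto simp: slide_def F'_def)
        then show ?thesis using step.IH by (rule rtrancl_into_rtrancl[rotated])
      qed simp
    qed simp
    then have path: "(a1, a) \<in> (slide F')\<^sup>*" using a1(2) by blast
    define u where "u = s - var_exp (1, 1) - var_exp (a0, 1) - var_exp (a1, b)"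
    define t where "t = u + var_exp (1, 1) + var_exp (a1, 1) + var_exp (a0, b)"
    have "(a0, 1) \<in> keys (s - var_exp (1, 1))" "(a1, b) \<in> keys (s - var_exp (1, 1))"
      using less.prems(4) a1b ge by (auto simp: in_keys_iff lookup_minus lookup_single when_def)
    then have "s - var_exp (1, 1) = u + var_exp (a0, 1) + var_exp (a1, b)"
      unfolding u_def using ge by (intro exponent_split_two) auto
    then have s_eq: "s = u + var_exp (a0, 1) + var_exp (a1, b) + var_exp (1, 1)"
      using minus_var_exp_add[OF less.prems(3)] by simp
    \<comment> \<open>One move is a forward and a backward step, meeting at \<open>u\<close> times
      the variables at \<open>(a0, 1)\<close>, \<open>(1, b)\<close> and
      \<open>(a1, 1)\<close>.\<close>
    have "minor_step (u + var_exp (a0, 1) + var_exp (1, 1) + var_exp (a1, b))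
        (u + var_exp (a0, 1) + var_exp (1, b) + var_exp (a1, 1))"
      using a1b by (intro minor_step.intros)
    moreover have "minor_step (u + var_exp (a1, 1) + var_exp (1, 1) + var_exp (a0, b))
        (u + var_exp (a1, 1) + var_exp (1, b) + var_exp (a0, 1))"
      using b by (intro minor_step.intros)
    moreover have "u + var_exp (a0, 1) + var_exp (1, 1) + var_exp (a1, b) = s"
      "u + var_exp (a1, 1) + var_exp (1, 1) + var_exp (a0, b) = t"
      "u + var_exp (a1, 1) + var_exp (1, b) + var_exp (a0, 1) = u + var_exp (a0, 1) + var_exp (1, b) + var_exp (a1, 1)"
      by (simp_all only: s_eq t_def add_ac)
    ultimately have st: "s \<approx> t" by (metis r_into_equivclp equivclp_into_equivclp)
    have keys_t: "(1, 1) \<in> keys t" "(a1, 1) \<in> keys t" by (auto simp: t_def keys_add_nat)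
    have keep: "v \<in> keys t" if "v \<in> keys s" "v \<noteq> (a0, 1)" "v \<noteq> (a1, b)" for v
      using that unfolding s_eq t_def by (auto simp: keys_add_nat)
    have "F' \<subseteq> keys t \<inter> E"
    proof
      fix v assume v: "v \<in> F'"
      then have "v \<in> keys s" "v \<in> E" "v \<noteq> (a1, b)" using less.prems(2) by (auto simp: F'_def)
      moreover have "v \<noteq> (a0, 1)" using E_ge[of a0 1] \<open>v \<in> E\<close> by auto
      ultimately show "v \<in> keys t \<inter> E" using keep by blast
    qed
    then obtain t' where t': "t \<approx> t'" "(1, 1) \<in> keys t'" "(a, 1) \<in> keys t'"
      "\<And>b. (1, b) \<in> keys t \<Longrightarrow> (1, b) \<in> keys t'"
      using less.hyps[OF card path _ keys_t] ge by auto
    have "(1, c) \<in> keys t'" if "(1, c) \<in> keys s" for c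
      using that keep[of "(1, c)"] t'(4) less.prems(5) ge by auto
    then show ?thesis using t' equivclp_trans[OF st] by blast
  qed
qed

text \<open>The cover is chosen so that the corner is the only variable of \<open>s\<close> with
  positive weight; the bound on the class makes its exponent one.\<close>

lemma cover_of_weight_one:
  assumes z: "(1, 1) \<in> keys s" and sq: "\<And>t. s \<approx> t \<Longrightarrow> lookup t (1, 1) < 2"
  shows "\<exists>W. min_cover W \<and> exp_weight (cover_weight W) s = 1"
proof -
  \<comment> \<open>The rows to which some row variable of \<open>s\<close> can be moved by sliding;
    this includes the rows of those variables themselves.\<close>
  define A where "A = {a. \<exists>a0. a0 \<noteq> 1 \<and> (a0, 1) \<in> keys s \<and> (a0, a) \<in> (slide (keys s \<inter> E))\<^sup>*}"
  define W where "W = cover_avoiding A"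
  have W: "min_cover W" unfolding W_def by (rule min_cover_cover_avoiding)
  \<comment> \<open>Otherwise \<open>b\<close> is adjacent to some row \<open>a\<close> of
    \<open>A\<close>. Sliding to row \<open>a\<close> keeps the corner, and a backward step on
    \<open>(a, b)\<close> then produces a second corner factor.\<close>
  have col: "(1, b) \<notin> W" if b: "(1, b) \<in> keys s" "b \<noteq> 1" for b
  proof
    assume "(1, b) \<in> W"
    then obtain a where a: "a \<in> A" "(a, b) \<in> E" using cover_avoiding_col[OF b(2)] W_def by blast
    then obtain t where t: "s \<approx> t" "(1, 1) \<in> keys t" "(a, 1) \<in> keys t" "(1, b) \<in> keys t"
      using slide_reachable[OF _ subset_refl z] b(1) unfolding A_def by blast
    have ge: "2 \<le> a" "2 \<le> b" using E_ge[OF a(2)] by auto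
    define u where "u = t - var_exp (1, b) - var_exp (a, 1)"
    have t_eq: "t = u + var_exp (1, b) + var_exp (a, 1)"
      unfolding u_def using t ge by (intro exponent_split_two) auto
    then have "s \<approx> u + var_exp (1, 1) + var_exp (a, b)"
      using minor_step.intros[OF a(2), of u] equivclp_into_equivclp[OF t(1)] by metis
    moreover have "(1, 1) \<in> keys u" using t(2) ge unfolding t_eq by (auto simp: keys_add_nat)
    then have "2 \<le> lookup (u + var_exp (1, 1) + var_exp (a, b)) (1, 1)"
      by (simp add: lookup_add in_keys_iff)
    ultimately show False using sq by fastforce
  qed
  have row: "(a, 1) \<notin> W" if "a \<in> A" "a \<noteq> 1" for a
    using that cover_avoiding_row unfolding W_def by blast
  have row': "(a, 1) \<notin> W" if "(a, 1) \<in> keys s" "a \<noteq> 1" for a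
    using that row[of a] unfolding A_def by blast
  have "cover_weight W v = 0" if v: "v \<in> keys s" "v \<noteq> (1, 1)" for v
  proof -
    obtain i j where ij: "v = (i, j)" by fastforce
    have "v \<notin> W"
    proof
      assume "v \<in> W"
      then have "i = 1 \<or> j = 1" using W ij unfolding min_cover_def by blast
      then show False using \<open>v \<in> W\<close> v ij col row' by blast
    qed
    moreover have "\<not> ((i, 1) \<in> W \<and> (1, j) \<in> W)" if e: "(i, j) \<in> E"
    proof
      assume w: "(i, 1) \<in> W \<and> (1, j) \<in> W"
      have ge: "i \<noteq> 1" "j \<noteq> 1" using E_ge[OF e] by auto
      then obtain a' where a': "a' \<in> A" "(a', j) \<in> E" using cover_avoiding_col w W_def by blast
      \<comment> \<open>The vertex \<open>(i, j)\<close> of \<open>s\<close> extends the path from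
        \<open>a'\<close> to \<open>i\<close>, so row \<open>i\<close> is avoided by the cover as
        well.\<close>
      then have "(a', i) \<in> slide (keys s \<inter> E)" using e v ij by (auto simp: slide_def)
      then have "i \<in> A" using a'(1) unfolding A_def by (blast intro: rtrancl_into_rtrancl)
      then show False using row ge w by blast
    qed
    ultimately show ?thesis using ij by (auto simp: cover_weight_def)
  qed
  then have "exp_weight (cover_weight W) s = (\<Sum>v\<in>{(1, 1)}. lookup s v * cover_weight W v)"
    unfolding exp_weight_def using z by (intro sum.mono_neutral_right) auto
  also have "\<dots> = 1"
    using W sq[OF equivclp_refl] z unfolding min_cover_def cover_weight_def in_keys_iff by simp
  finally show ?thesis using W by blast
qed

section \<open>The decomposition\<close>

text \<open>This is \<open>I\<close> plus the ideal of the squared corner variable, written so that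
  the cofactor \<open>h\<close> can be extracted.\<close>

lemma corner_square_ideal: "C \<noteq> {} \<Longrightarrow>
    ideal {i + indet (1, 1) * indet (1, 1) * h | i h. i \<in> I \<and> poly_vars h \<subseteq> V} (S :: 'k::field mpoly ring)"
  (is "_ \<Longrightarrow> ideal ?Q _")
proof (rule polyring_idealI)
  let ?z = "indet (1, 1) * indet (1, 1) :: 'k mpoly"
  assume C: "C \<noteq> {}"
  have z: "poly_vars ?z \<subseteq> V"
    using poly_vars_mult[of "indet (1, 1) :: 'k mpoly" "indet (1, 1)"] corner_in_V[OF C] by auto
  show "?Q \<subseteq> carrier S"
  proof
    fix f assume "f \<in> ?Q"
    then obtain i h where f: "i \<in> I" "poly_vars h \<subseteq> V" "f = i + ?z * h" by blast
    then have "poly_vars f \<subseteq> V"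
      using poly_vars_add[of i "?z * h"] poly_vars_mult[of ?z h] z polyring_ideal_vars[OF ideal_I f(1)]
      unfolding f(3) by blast
    then show "f \<in> carrier S" by simp
  qed
  show "0 \<in> ?Q" using polyring_ideal_0[OF ideal_I] by (intro CollectI exI[of _ 0]) simp
  show "f + g \<in> ?Q" if f: "f \<in> ?Q" and g: "g \<in> ?Q" for f g
  proof -
    obtain i h where ih: "i \<in> I" "poly_vars h \<subseteq> V" "f = i + ?z * h" using f by blast
    obtain i' h' where ih': "i' \<in> I" "poly_vars h' \<subseteq> V" "g = i' + ?z * h'" using g by blast
    have "poly_vars (h + h') \<subseteq> V" "i + i' \<in> I"
      using poly_vars_add[of h h'] ih(2) ih'(2) polyring_ideal_add[OF ideal_I ih(1) ih'(1)] by blast+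
    moreover have "f + g = (i + i') + ?z * (h + h')" using ih(3) ih'(3) by (simp add: algebra_simps)
    ultimately show ?thesis by blast
  qed
  show "k * f \<in> ?Q" if f: "f \<in> ?Q" and k: "poly_vars k \<subseteq> V" for k f
  proof -
    obtain i h where ih: "i \<in> I" "poly_vars h \<subseteq> V" "f = i + ?z * h" using f by blast
    have "poly_vars (k * h) \<subseteq> V" "k * i \<in> I"
      using poly_vars_mult[of k h] k ih(2) polyring_ideal_mult[OF ideal_I ih(1) k] by blast+
    moreover have "k * f = k * i + ?z * (k * h)" using ih(3) by (simp add: algebra_simps)
    ultimately show ?thesis by blast
  qed
qed

lemma mem_I_if:
  assumes C: "C \<noteq> {}" and fJ: "f \<in> (J :: 'k::field mpoly set)"
    and fP: "\<And>W. W \<in> minimal_admissible_sets TYPE('k) C \<Longrightarrow> min_cover W \<Longrightarrow> f \<in> P W"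
    and fP2: "\<And>W. W \<in> minimal_admissible_sets TYPE('k) C \<Longrightarrow> min_cover W \<Longrightarrow>
      f \<in> I <+>\<^bsub>S\<^esub> (P W \<cdot>\<^bsub>S\<^esub> (P W :: 'k mpoly set))"
  shows "f \<in> I"
proof -
  let ?z = "indet (1, 1) * indet (1, 1) :: 'k mpoly"
  let ?Q = "{i + ?z * h | i h. i \<in> I \<and> poly_vars h \<subseteq> V}"
  note Q = corner_square_ideal[OF C, where 'k = 'k]
  have IQ: "I \<subseteq> ?Q" by (intro subsetI CollectI) (metis add_0_right mult_zero_right poly_vars_zero empty_subsetI)
  have keys_V: "keys s \<subseteq> V" if "s \<in> keys f" for s
    using that polyring_ideal_vars[OF ideal_J fJ] by (auto simp: poly_vars_def)
  \<comment> \<open>If \<open>W\<close> is not among the minimal admissible sets, then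
    \<open>P W\<close> contains \<open>J\<close> and therefore \<open>f\<close>.\<close>
  have allP: "f \<in> P W" if W: "min_cover W" for W
    using fP[OF min_cover_minimal_admissible[OF W C] W] fJ by blast
  have corner_class: "\<exists>t. s \<approx> t \<and> (1, 1) \<in> keys t" if "s \<in> keys f" for s
    using corner_in_class[OF corner_or_edge[OF allP C that]] .
  have cls: "monomial s \<in> ?Q \<or> (\<Sum>t\<in>{t \<in> keys f. s \<approx> t}. lookup f t) = 0" if s: "s \<in> keys f" for s
  proof (cases "\<exists>t. s \<approx> t \<and> 2 \<le> lookup t (1, 1)")
    case True
    then obtain t where t: "s \<approx> t" "2 \<le> lookup t (1, 1)" by blast
    define u where "u = t - var_exp (1, 1) - var_exp (1, 1)"
    have "t = var_exp (1, 1) + var_exp (1, 1) + u"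
      unfolding u_def using t(2)
      by (intro poly_mapping_eqI) (auto simp: lookup_add lookup_minus lookup_single when_def)
    then have "monomial t = ?z * monomial u" by (simp only: monomial_add indet_eq_monomial)
    then have "monomial s = (monomial s - monomial t) + ?z * monomial u" by simp
    moreover have "monomial s - monomial t \<in> (I :: 'k mpoly set)"
      using diff_minor_eqv_mem_I[OF t(1) keys_V[OF s]] .
    moreover have "keys t \<subseteq> V" using keys_minor_eqv[OF t(1)] keys_V[OF s] by blast
    then have "keys u \<subseteq> V"
      unfolding u_def by (intro order_trans[OF keys_minus_nat] order_trans[OF keys_minus_nat])
    then have "poly_vars (monomial u :: 'k mpoly) \<subseteq> V" by simp
    ultimately show ?thesis by blast
  next
    case False
    obtain t where t: "s \<approx> t" "(1, 1) \<in> keys t" using corner_class[OF s] by blast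
    have "lookup u (1, 1) < 2" if "t \<approx> u" for u
      using False equivclp_trans[OF t(1) that] by (simp add: not_le)
    then obtain W where W: "min_cover W" "exp_weight (cover_weight W) t = 1"
      using cover_of_weight_one[OF t(2)] by blast
    note WV = min_cover_subset_V[OF W(1) C]
    have class_eq: "{u \<in> keys f. s \<approx> u} = {u \<in> keys f. t \<approx> u}"
      using equivclp_trans[OF t(1)] equivclp_trans[OF equivclp_sym[OF t(1)]] by blast
    \<comment> \<open>The square condition is available when \<open>P W\<close> does not contain
      \<open>J\<close>; in the other case the class is compared with a whole Segre fibre of terms of
      \<open>f\<close>.\<close>
    have "(\<Sum>u\<in>{u \<in> keys f. t \<approx> u}. lookup f u) = 0"
    proof (cases "J \<subseteq> (P W :: 'k mpoly set)")
      case False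
      note fP2[OF min_cover_minimal_admissible[OF W(1) C False] W(1)]
      then show ?thesis by (rule class_sum_I_add_P_square[OF W(1) WV _ W(2)])
    next
      case True
      \<comment> \<open>Replace \<open>u\<close> by an equivalent monomial divisible by the corner
        and divide it and \<open>t\<close> by the corner. The quotients differ by an element of
        \<open>J \<subseteq> P W\<close>, so if they were distinct the quotient of \<open>t\<close>
        would contain a variable of \<open>W\<close>. That quotient has weight zero.\<close>
      have "t \<approx> u" if u: "u \<in> keys f" "segre u = segre t" for u
      proof -
        obtain u' where u': "u \<approx> u'" "(1, 1) \<in> keys u'" using corner_class[OF u(1)] by blast
        let ?t = "t - var_exp (1, 1)" and ?u = "u' - var_exp (1, 1)"
        have t_eq: "?t + var_exp (1, 1) = t" and u_eq: "?u + var_exp (1, 1) = u'"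
          using t(2) u'(2) by (simp_all only: minus_var_exp_add)
        have "segre u' = segre t" using segre_minor_eqv[OF u'(1)] u(2) by simp
        then have "segre ?t = segre ?u"
          using segre_add[of ?t "var_exp (1, 1)"] segre_add[of ?u "var_exp (1, 1)"]
          unfolding t_eq u_eq by simp
        moreover have "keys t \<subseteq> V" "keys u' \<subseteq> V"
          using keys_minor_eqv[OF t(1)] keys_minor_eqv[OF u'(1)] keys_V[OF s] keys_V[OF u(1)] by auto
        then have "keys ?t \<subseteq> V" "keys ?u \<subseteq> V" by (simp_all only: order_trans[OF keys_minus_nat])
        ultimately have "(monomial ?t - monomial ?u :: 'k mpoly) \<in> segre_ideal V"
          by (intro diff_mem_segre_ideal)
        then have mem: "(monomial ?t - monomial ?u :: 'k mpoly) \<in> P W"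
          by (rule subsetD[OF True[unfolded J_eq_segre_ideal]])
        have "keys ?t \<inter> W \<noteq> {}" if "?t \<noteq> ?u"
        proof -
          have "?t \<in> keys (monomial ?t - monomial ?u :: 'k mpoly)"
            using that by (simp add: in_keys_iff lookup_minus lookup_monomial)
          then show ?thesis using iffD1[OF mem_genideal_indet_iff[OF WV] mem] by (elim conjE) (rule bspec)
        qed
        moreover have "keys ?t \<inter> W = {}"
        proof (rule ccontr)
          assume "keys ?t \<inter> W \<noteq> {}"
          then obtain v where v: "v \<in> keys ?t" "v \<in> W" by blast
          have "1 \<le> exp_weight (cover_weight W) ?t"
            using exp_weight_ge[OF v(1), of "cover_weight W"] v(2) by (simp add: cover_weight_def)
          moreover have "cover_weight W (1, 1) = 1"
            using W(1) by (simp add: min_cover_def cover_weight_def)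
          then have "exp_weight (cover_weight W) ?t + 1 = 1"
            using W(2) exp_weight_add[of "cover_weight W" ?t "var_exp (1, 1)"]
            unfolding t_eq exp_weight_var_exp by simp
          ultimately show False by simp
        qed
        ultimately have "?t = ?u" by (cases "?t = ?u") simp_all
        then have "?t + var_exp (1, 1) = ?u + var_exp (1, 1)" by simp
        then show ?thesis using equivclp_sym[OF u'(1)] unfolding t_eq u_eq by simp
      qed
      then have "t \<approx> u \<longleftrightarrow> segre u = segre t" if "u \<in> keys f" for u
        using that segre_minor_eqv[of t u] by auto
      then have "{u \<in> keys f. t \<approx> u} = {u \<in> keys f. segre u = segre t}" by blast
      then show ?thesis using segre_ideal_class_sum[of f V] fJ by (simp add: J_eq_segre_ideal)
    qed
    then show ?thesis using class_eq by simp
  qed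
  have "f \<in> ?Q"
  proof (rule mem_ideal_by_classes[OF Q, where R = minor_eqv])
    show "monomial s - monomial t \<in> ?Q" if "s \<in> keys f" "t \<in> keys f" "s \<approx> t" for s t
      using diff_minor_eqv_mem_I[OF that(3) keys_V[OF that(1)], where 'k = 'k] IQ by blast
  qed (use cls in auto)
  then obtain i h where ih: "i \<in> I" "poly_vars h \<subseteq> V" "f = i + ?z * h" by blast
  interpret J: primeideal J "S :: 'k mpoly ring" by (rule primeideal_J)
  have "?z * h = f - i" using ih(3) by simp
  then have "?z * h \<in> J"
    using polyring_ideal_diff[OF ideal_J fJ subsetD[OF I_subset_J ih(1)]] by simp
  moreover have "poly_vars (indet (1, 1) :: 'k mpoly) \<subseteq> V" using corner_in_V[OF C] by simp
  moreover from this have "poly_vars ?z \<subseteq> V" using poly_vars_mult[of "indet (1, 1) :: 'k mpoly" "indet (1, 1)"] by blast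
  ultimately have "h \<in> J"
    using J.I_prime[of ?z h] J.I_prime[of "indet (1, 1)" "indet (1, 1)"] ih(2) not_mem_J by auto
  then have "?z * h \<in> I" by (rule corner_square_mult_J[OF _ C])
  then show ?thesis using polyring_ideal_add[OF ideal_I ih(1)] ih(3) by simp
qed

lemma I_subset_add_square:
  assumes "ideal Q (S :: 'k::field mpoly ring)"
  shows "I \<subseteq> I <+>\<^bsub>S\<^esub> (Q \<cdot>\<^bsub>S\<^esub> Q)"
proof
  fix f :: "'k mpoly" assume "f \<in> I"
  \<comment> \<open>Zero is exhibited as a product because membership in \<open>ideal_prod\<close>
    starts from products.\<close>
  moreover have "0 * 0 \<in> Q \<cdot>\<^bsub>S\<^esub> Q"
    using ideal_prod.prod[of 0 Q 0 Q S] polyring_ideal_0[OF assms] by simp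
  ultimately show "f \<in> I <+>\<^bsub>S\<^esub> (Q \<cdot>\<^bsub>S\<^esub> Q)"
    unfolding mem_polyring_set_add by (intro bexI[of _ f] bexI[of _ "0 * 0"]) simp_all
qed

lemma decomposition:
  "(I :: 'k::field mpoly set) =
    ideal_Inter S (minimal_admissible_sets TYPE('k) C) (admissible_ideal C) \<inter>
    ideal_Inter S (minimal_admissible_sets TYPE('k) C - {{}})
      (\<lambda>W. I <+>\<^bsub>S\<^esub> (admissible_ideal C W \<cdot>\<^bsub>S\<^esub> admissible_ideal C W))"
proof
  have prime: "primeideal (admissible_ideal C W :: 'k mpoly set) S \<and> I \<subseteq> (admissible_ideal C W :: 'k mpoly set)"
    if "W \<in> minimal_admissible_sets TYPE('k) C" for W
    using that by (auto simp: minimal_admissible_sets_def minimal_prime_def coord_ring_def)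
  then have "I \<subseteq> (I :: 'k mpoly set) <+>\<^bsub>S\<^esub> (admissible_ideal C W \<cdot>\<^bsub>S\<^esub> admissible_ideal C W)"
    if "W \<in> minimal_admissible_sets TYPE('k) C" for W
    using that I_subset_add_square primeideal.axioms(1) by blast
  moreover have "I \<subseteq> carrier (S :: 'k mpoly ring)"
    using polyring_ideal_vars[OF ideal_I] by auto
  ultimately show "I \<subseteq> ideal_Inter S (minimal_admissible_sets TYPE('k) C) (admissible_ideal C) \<inter>
    ideal_Inter S (minimal_admissible_sets TYPE('k) C - {{}})
      (\<lambda>W. (I :: 'k mpoly set) <+>\<^bsub>S\<^esub> (admissible_ideal C W \<cdot>\<^bsub>S\<^esub> admissible_ideal C W))"
    using prime unfolding ideal_Inter_def by blast
next
  show "ideal_Inter S (minimal_admissible_sets TYPE('k) C) (admissible_ideal C) \<inter>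
    ideal_Inter S (minimal_admissible_sets TYPE('k) C - {{}})
      (\<lambda>W. I <+>\<^bsub>S\<^esub> (admissible_ideal C W \<cdot>\<^bsub>S\<^esub> admissible_ideal C W)) \<subseteq> (I :: 'k mpoly set)"
  proof
    fix f :: "'k mpoly"
    assume "f \<in> ideal_Inter S (minimal_admissible_sets TYPE('k) C) (admissible_ideal C) \<inter>
      ideal_Inter S (minimal_admissible_sets TYPE('k) C - {{}})
        (\<lambda>W. I <+>\<^bsub>S\<^esub> (admissible_ideal C W \<cdot>\<^bsub>S\<^esub> admissible_ideal C W))"
    then have f1: "\<And>W. W \<in> minimal_admissible_sets TYPE('k) C \<Longrightarrow> f \<in> admissible_ideal C W"
      and f2: "\<And>W. W \<in> minimal_admissible_sets TYPE('k) C \<Longrightarrow> W \<noteq> {} \<Longrightarrow> f \<in> I <+>\<^bsub>S\<^esub> (admissible_ideal C W \<cdot>\<^bsub>S\<^esub> (admissible_ideal C W :: 'k mpoly set))"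
      unfolding ideal_Inter_def by auto
    \<comment> \<open>The index \<open>W = {}\<close> always occurs in the first intersection and
      contributes \<open>J\<close>.\<close>
    have fJ: "f \<in> J"
      using f1[OF empty_minimal_admissible] by (simp add: admissible_ideal_empty)
    show "f \<in> I"
    proof (cases "C = {}")
      case True
      then have "(J :: 'k mpoly set) = {0}" using cycle_ideal_empty by simp
      then show ?thesis using fJ polyring_ideal_0[OF ideal_I] by simp
    next
      case False
      then show ?thesis
      proof (rule mem_I_if[OF _ fJ])
        fix W assume W: "W \<in> minimal_admissible_sets TYPE('k) C" "min_cover W"
        then have "W \<noteq> {}" by (auto simp: min_cover_def)
        then show "f \<in> P W" "f \<in> I <+>\<^bsub>S\<^esub> (P W \<cdot>\<^bsub>S\<^esub> (P W :: 'k mpoly set))"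
          using f1[OF W(1)] f2[OF W(1)] unfolding admissible_ideal_min_cover[OF W(2)] by blast+
      qed
    qed
  qed
qed

end

theorem proposition4p7:
  fixes m n :: nat and C :: "minor set"
  assumes "\<forall>d\<in>C. is_corner_minor m n d"
  shows "(minor_ideal C :: 'k::field mpoly set) =
    ideal_Inter (coord_ring C) (minimal_admissible_sets TYPE('k) C) (\<lambda>W. admissible_ideal C W) \<inter>
    ideal_Inter (coord_ring C) (minimal_admissible_sets TYPE('k) C - {{}})
      (\<lambda>W. minor_ideal C <+>\<^bsub>coord_ring C\<^esub>
             (admissible_ideal C W \<cdot>\<^bsub>coord_ring C\<^esub> admissible_ideal C W))"
proof -
  interpret corner_minors C
  proof
    fix d assume "d \<in> C"
    then show "\<exists>a b. d = (1, a, 1, b) \<and> 2 \<le> a \<and> 2 \<le> b"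
      using assms by (cases d) fastforce
  qed
  show ?thesis using decomposition[where 'k = 'k] unfolding coord_ring_def .
qed

end
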